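(* Let $\tilde\theta_i$ stand for any one of the feasible estimators $\tilde\theta_{H,i}$, $\tilde\theta_{S,i}$, $\tilde\theta_{AS,i}$. Suppose that for given $i\ge 1$ satisfying $i\le k=k(n)$ for large enough $n$ we have $\xi_{i,n}\eta_{i,n}\to 0$ and $n^{1/2}\eta_{i,n}\to e_i$ as $n\to\infty$, where $0\le e_i\le\infty$. (a) Assume $e_i<\infty$. Suppose that the true parameters $\theta^{(n)}=(\theta_{1,n},\dots,\theta_{k_n,n})\in\mathbb{R}^{k_n}$ (with $k_n=k(n)$) and $\sigma_n\in(0,\infty)$ satisfy $n^{1/2}\theta_{i,n}/(\sigma_n\xi_{i,n})\to\nu_i\in\bar{\mathbb{R}}$. (a1) If $n-k$ is eventually constant equal to $m$, say, then $$\lim_{n\to\infty}P_{n,\theta^{(n)},\sigma_n}(\tilde\theta_i=0)=\int_0^\infty\left(\Phi(-\nu_i+se_i)-\Phi(-\nu_i-se_i)\right)\rho_m(s)\,ds.$$ (a2) If $n-k\to\infty$, then $$\lim_{n\to\infty}P_{n,\theta^{(n)},\sigma_n}(\tilde\theta_i=0)=\Phi(-\nu_i+e_i)-\Phi(-\nu_i-e_i).$$ (b) Assume $e_i=\infty$. Suppose that the true parameters $\theta^{(n)}=(\theta_{1,n},\dots,\theta_{k_n,n})\in\mathbb{R}^{k_n}$ and $\sigma_n\in(0,\infty)$ satisfy $\theta_{i,n}/(\sigma_n\xi_{i,n}\eta_{i,n})\to\zeta_i\in\bar{\mathbb{R}}$. (b1) If $n-k$ is eventually constant equal to $m$, say,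 then $$\lim_{n\to\infty}P_{n,\theta^{(n)},\sigma_n}(\tilde\theta_i=0)=\int_{|\zeta_i|}^\infty\rho_m(s)\,ds=\Pr(\chi_m^2>m\zeta_i^2).$$ (b2) If $n-k\to\infty$, then, with $r_{i,n}:=n^{1/2}\left(\eta_{i,n}-\zeta_i\theta_{i,n}/(\sigma_n\xi_{i,n})\right)$ (used only when $|\zeta_i|=1$): 1. $|\zeta_i|<1$ implies $\lim_{n\to\infty}P_{n,\theta^{(n)},\sigma_n}(\tilde\theta_i=0)=1$. 2. $|\zeta_i|>1$ implies $\lim_{n\to\infty}P_{n,\theta^{(n)},\sigma_n}(\tilde\theta_i=0)=0$. 3. $|\zeta_i|=1$ and $n^{1/2}\eta_{i,n}/(n-k)^{1/2}\to0$ imply $\lim_{n\to\infty}P_{n,\theta^{(n)},\sigma_n}(\tilde\theta_i=0)=\Phi(r_i)$ provided $r_{i,n}\to r_i$ for some $r_i\in\bar{\mathbb{R}}$. 4. $|\zeta_i|=1$ and $n^{1/2}\eta_{i,n}/(n-k)^{1/2}\to2^{1/2}d_i$ with $0<d_i<\infty$ imply $$\lim_{n\to\infty}P_{n,\theta^{(n)},\sigma_n}(\tilde\theta_i=0)=\int_{-\infty}^\infty\Phi(d_it+r_i)\phi(t)\,dt$$ provided $r_{i,n}\to r_i$ for some $r_i\in\bar{\mathbb{R}}$. (The integral reduces to $1$ if $r_i=\infty$ and to $0$ if $r_i=-\infty$.) 5. $|\zeta_i|=1$ and $n^{1/2}\eta_{i,n}/(n-k)^{1/2}\to\infty$ imply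 $\lim_{n\to\infty}P_{n,\theta^{(n)},\sigma_n}(\tilde\theta_i=0)=\Phi(r_i')$ provided $\left(n^{1/2}\eta_{i,n}/(n-k)^{1/2}\right)^{-1}r_{i,n}\to2^{-1/2}r_i'$ for some $r_i'\in\bar{\mathbb{R}}$.
   Context: For each sample size $n$ consider the linear regression model $Y=X\theta+u$, where $X$ is a nonstochastic $n\times k$ matrix of rank $k\ge1$ with $k<n$, $\theta\in\mathbb{R}^k$, $u\sim N(0,\sigma^2I_n)$, $0<\sigma<\infty$. The number $k=k(n)$, the entries of $X,Y,u$ and the underlying probability space may depend on $n$. $P_{n,\theta,\sigma}$ denotes probability under parameters $\theta,\sigma$. $X'$ is the transpose of $X$. $\xi_{i,n}$ is the nonnegative square root of the $i$-th diagonal element of $(X'X/n)^{-1}$. $\hat\theta_{LS}=(X'X)^{-1}X'Y$ with $i$-th component $\hat\theta_{LS,i}$, and $\hat\sigma^2=(n-k)^{-1}(Y-X\hat\theta_{LS})'(Y-X\hat\theta_{LS})$, $\hat\sigma\ge0$. The tuning parameters $\eta_{i,n}$ are positive real numbers. Feasible thresholding estimators: hard: $\tilde\theta_{H,i}=\hat\theta_{LS,i}\mathbf{1}(|\hat\theta_{LS,i}|>\hat\sigma\xi_{i,n}\eta_{i,n})$; soft: $\tilde\theta_{S,i}=\mathrm{sign}(\hat\theta_{LS,i})(|\hat\theta_{LS,i}|-\hat\sigma\xi_{i,n}\eta_{i,n})_+$; adaptive soft: $\tilde\theta_{AS,i}=\hat\theta_{LS,i}(1-\hat\sigma^2\xi_{i,n}^2\eta_{i,n}^2/\hat\theta_{LS,i}^2)_+$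 (equal to $0$ if $|\hat\theta_{LS,i}|\le\hat\sigma\xi_{i,n}\eta_{i,n}$). Here $(\cdot)_+=\max(\cdot,0)$. Standing assumption for all asymptotics: $\sup_n\xi_{j,n}^2/n<\infty$ for every fixed $j\ge1$ satisfying $j\le k(n)$ for large enough $n$. $\Phi,\phi$ are the standard normal cdf and pdf, with $\Phi(\infty)=1$, $\Phi(-\infty)=0$; $\bar{\mathbb{R}}=\mathbb{R}\cup\{-\infty,\infty\}$ with the usual topology. $\chi_m^2$ denotes a chi-square random variable with $m$ degrees of freedom; $\rho_m$ is the density of $m^{-1/2}$ times the square root of a $\chi^2_m$ random variable, with $\rho_m(s)=0$ for $s<0$. *)

theory Defs
  imports
    "HOL-Probability.Probability"
    "Jordan_Normal_Form.DL_Rank"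
    "Jordan_Normal_Form.Gauss_Jordan_Elimination"
begin

unbundle no vec_syntax
no_notation inner (infixl "\<bullet>" 70)

text \<open>
  The sample size varies inside the statements, so design matrices and data vectors live in the
  carrier-based types of \<open>Jordan_Normal_Form\<close>. Coordinates are numbered from \<open>0\<close>, so
  \<open>i < k\<close> here plays the role of the customary \<open>1 \<le> i \<le> k\<close>.
\<close>

subsection \<open>The Gaussian linear regression model\<close>

text \<open>\<open>u \<sim> N(0, \<sigma>\<^sup>2 I\<^sub>n)\<close>: the \<open>n\<close> coordinates are independent and each is \<open>N(0, \<sigma>\<^sup>2)\<close>.
  The second parameter of \<^const>\<open>normal_density\<close> is the standard deviation.\<close>

definition spherical_normal :: "'a measure \<Rightarrow> nat \<Rightarrow> real \<Rightarrow> ('a \<Rightarrow> real Matrix.vec) \<Rightarrow> bool" where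
  "spherical_normal M n \<sigma> u \<longleftrightarrow>
     (\<forall>\<omega>\<in>space M. u \<omega> \<in> carrier_vec n) \<and>
     prob_space.indep_vars M (\<lambda>_. borel) (\<lambda>j \<omega>. u \<omega> $ j) {..<n} \<and>
     (\<forall>j<n. distributed M lborel (\<lambda>\<omega>. u \<omega> $ j) (\<lambda>x. ennreal (normal_density 0 \<sigma> x)))"

text \<open>The family \<open>P\<close> of probability measures is indexed by the parameters \<open>(\<theta>, \<sigma>)\<close>; under
  \<open>P \<theta> \<sigma>\<close> the error vector is \<open>u = Y - X\<theta>\<close>.\<close>

definition gaussian_regression ::
    "real mat \<Rightarrow> ('a \<Rightarrow> real Matrix.vec) \<Rightarrow> (real Matrix.vec \<Rightarrow> real \<Rightarrow> 'a measure) \<Rightarrow> bool" where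
  "gaussian_regression X Y P \<longleftrightarrow>
     (\<forall>\<theta>\<in>carrier_vec (dim_col X). \<forall>\<sigma>>0.
        prob_space (P \<theta> \<sigma>) \<and>
        (\<forall>\<omega>\<in>space (P \<theta> \<sigma>). Y \<omega> \<in> carrier_vec (dim_row X)) \<and>
        spherical_normal (P \<theta> \<sigma>) (dim_row X) \<sigma> (\<lambda>\<omega>. Y \<omega> - X *\<^sub>v \<theta>))"

subsection \<open>Least squares\<close>

definition \<xi> :: "real mat \<Rightarrow> nat \<Rightarrow> real" where
  "\<xi> X i = sqrt (the (mat_inverse ((1 / real (dim_row X)) \<cdot>\<^sub>m (X\<^sup>T * X))) $$ (i, i))"

definition ls_estimator :: "real mat \<Rightarrow> real Matrix.vec \<Rightarrow> real Matrix.vec" where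
  "ls_estimator X y = the (mat_inverse (X\<^sup>T * X)) *\<^sub>v (X\<^sup>T *\<^sub>v y)"

definition sigma_hat :: "real mat \<Rightarrow> real Matrix.vec \<Rightarrow> real" where
  "sigma_hat X y =
     (let r = y - X *\<^sub>v ls_estimator X y
      in sqrt ((r \<bullet> r) / real (dim_row X - dim_col X)))"

subsection \<open>Feasible thresholding estimators\<close>

definition hard_threshold :: "real mat \<Rightarrow> nat \<Rightarrow> real \<Rightarrow> real Matrix.vec \<Rightarrow> real" where
  "hard_threshold X i \<eta> y =
     ls_estimator X y $ i *
     of_bool (\<bar>ls_estimator X y $ i\<bar> > sigma_hat X y * \<xi> X i * \<eta>)"

definition soft_threshold :: "real mat \<Rightarrow> nat \<Rightarrow> real \<Rightarrow> real Matrix.vec \<Rightarrow> real" where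
  "soft_threshold X i \<eta> y =
     sgn (ls_estimator X y $ i) *
     max 0 (\<bar>ls_estimator X y $ i\<bar> - sigma_hat X y * \<xi> X i * \<eta>)"

text \<open>If the least squares component vanishes, so does the product below, whatever the value of
  the quotient.\<close>

definition adaptive_soft_threshold :: "real mat \<Rightarrow> nat \<Rightarrow> real \<Rightarrow> real Matrix.vec \<Rightarrow> real" where
  "adaptive_soft_threshold X i \<eta> y =
     ls_estimator X y $ i *
     max 0 (1 - (sigma_hat X y)\<^sup>2 * (\<xi> X i)\<^sup>2 * \<eta>\<^sup>2 / (ls_estimator X y $ i)\<^sup>2)"

subsection \<open>Limiting distributions\<close>

definition \<Phi> :: "ereal \<Rightarrow> real" where
  "\<Phi> x = (case x of ereal r \<Rightarrow> cdf std_normal_distribution r | PInfty \<Rightarrow> 1 | MInfty \<Rightarrow> 0)"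

definition chi_square :: "nat \<Rightarrow> real measure" where
  "chi_square m =
     distr (PiM {..<m} (\<lambda>_. std_normal_distribution)) borel (\<lambda>z. \<Sum>j<m. (z j)\<^sup>2)"

text \<open>The density of \<open>m\<^sup>-\<^sup>1\<^sup>/\<^sup>2\<close> times the square root of a chi-square variable, in the version
  that vanishes on the negative half-line.\<close>

definition \<rho> :: "nat \<Rightarrow> real \<Rightarrow> real" where
  "\<rho> m s =
     (if s < 0 then 0
      else enn2real (RN_deriv lborel
             (distr (chi_square m) borel (\<lambda>x. sqrt x / sqrt (real m))) s))"

end

theory Submission
  imports Defs
begin

text \<open>
  Write \<open>Z = \<surd>n (\<theta>\<^sub>L\<^sub>S\<^sub>,\<^sub>i - \<theta>\<^sub>i) / (\<sigma> \<xi>\<^sub>i)\<close> for the standardised least squares component and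
  \<open>S = \<sigma>\<^sub>h\<^sub>a\<^sub>t / \<sigma>\<close>. Each of the three estimators vanishes exactly when the least squares component
  does not exceed the threshold in absolute value, and this event reads \<open>\<bar>\<mu> + Z\<bar> \<le> a S\<close> with
  \<open>\<mu> = \<surd>n \<theta>\<^sub>i / (\<sigma> \<xi>\<^sub>i)\<close> and \<open>a = \<surd>n \<eta>\<^sub>i\<close>. So the whole theorem is about the law of the pair \<open>(Z, S)\<close>.

  The first half of the argument is exact. A composition of plane rotations of \<open>\<real>\<^sup>n\<close> turns the design
  matrix into upper triangular form, so that \<open>Z\<close> becomes a unit-norm combination of the first \<open>k\<close>
  rotated errors while the residual sum of squares becomes the sum of squares of the last \<open>n - k\<close>
  (\<open>full_column_rank_rotation\<close>). Since rotations preserve independent standard normal errors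
  (\<open>iid_std_normal_rotations\<close>), \<open>Z\<close> is standard normal, \<open>(n - k) S\<^sup>2\<close> is chi-square with
  \<open>n - k\<close> degrees of freedom, and the two are independent. Conditioning on \<open>S\<close> gives
  \<open>P(estimator = 0) = E (\<Phi> (a S - \<mu>) - \<Phi> (- a S - \<mu>))\<close>, which is \<open>prob_estimator_eq_0\<close>.

  The second half takes limits under this expectation; the integrand is bounded by one, so pointwise
  convergence is enough. If \<open>n - k\<close> is eventually a constant \<open>m\<close>, the law of \<open>S\<close> does not move. It is
  absolutely continuous (\<open>absolutely_continuous_scaled_chi\<close>), hence has density \<open>\<rho> m\<close> and
  no atom at the point \<open>\<bar>\<zeta>\<bar>\<close>, where the limiting integrand jumps. If \<open>n - k\<close> tends to infinity,
  the central limit theorem and Skorohod's theorem provide copies of \<open>S\<close> on one probability space for which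
  \<open>S \<rightarrow> 1\<close> and \<open>\<surd>(n - k) (S - 1) \<rightarrow> T / \<surd>2\<close> hold pointwise, with \<open>T\<close> standard normal
  (\<open>scaled_chi_coupling\<close>). In the critical case \<open>\<zeta> = 1\<close>, to which \<open>\<zeta> = -1\<close> reduces by symmetry,
  the upper end point is \<open>a S - \<mu> = r + \<kappa> \<surd>(n - k) (S - 1)\<close> with \<open>r = a - \<mu>\<close> and \<open>\<kappa> = a / \<surd>(n - k)\<close>,
  while the lower one tends to \<open>-\<infinity>\<close>.
  The three regimes for \<open>\<kappa>\<close> decide whether \<open>r\<close>, both terms, or \<open>\<kappa>\<close> times a shifted normal variable
  determine the limit.
\<close>

section \<open>Rotation invariance of independent standard normals\<close>

lemma nn_integral_shear_fst:
  fixes h :: "real \<times> real \<Rightarrow> ennreal"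
  assumes [measurable]: "h \<in> borel_measurable (borel \<Otimes>\<^sub>M borel)"
  shows "(\<integral>\<^sup>+z. h (fst z + t * snd z, snd z) \<partial>(lborel \<Otimes>\<^sub>M lborel)) = (\<integral>\<^sup>+z. h z \<partial>(lborel \<Otimes>\<^sub>M lborel))"
proof -
  have "(\<integral>\<^sup>+z. h (fst z + t * snd z, snd z) \<partial>(lborel \<Otimes>\<^sub>M lborel))
      = (\<integral>\<^sup>+y. (\<integral>\<^sup>+x. h (x + t * y, y) \<partial>lborel) \<partial>lborel)"
    by (subst lborel_pair.nn_integral_snd[symmetric]) simp_all
  also have "\<dots> = (\<integral>\<^sup>+y. (\<integral>\<^sup>+x. h (x, y) \<partial>lborel) \<partial>lborel)"
  proof (rule nn_integral_cong)
    fix y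
    show "(\<integral>\<^sup>+x. h (x + t * y, y) \<partial>lborel) = (\<integral>\<^sup>+x. h (x, y) \<partial>lborel)"
      using nn_integral_real_affine[of "\<lambda>x. h (x, y)" 1 "t * y"] by (simp add: add.commute)
  qed
  also have "\<dots> = (\<integral>\<^sup>+z. h z \<partial>(lborel \<Otimes>\<^sub>M lborel))"
    by (subst lborel_pair.nn_integral_snd) simp_all
  finally show ?thesis .
qed

lemma nn_integral_shear_snd:
  fixes h :: "real \<times> real \<Rightarrow> ennreal"
  assumes [measurable]: "h \<in> borel_measurable (borel \<Otimes>\<^sub>M borel)"
  shows "(\<integral>\<^sup>+z. h (fst z, snd z + t * fst z) \<partial>(lborel \<Otimes>\<^sub>M lborel)) = (\<integral>\<^sup>+z. h z \<partial>(lborel \<Otimes>\<^sub>M lborel))"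
proof -
  have "(\<integral>\<^sup>+z. h (fst z, snd z + t * fst z) \<partial>(lborel \<Otimes>\<^sub>M lborel))
      = (\<integral>\<^sup>+x. (\<integral>\<^sup>+y. h (x, y + t * x) \<partial>lborel) \<partial>lborel)"
    by (subst lborel.nn_integral_fst[symmetric]) simp_all
  also have "\<dots> = (\<integral>\<^sup>+x. (\<integral>\<^sup>+y. h (x, y) \<partial>lborel) \<partial>lborel)"
  proof (rule nn_integral_cong)
    fix x
    show "(\<integral>\<^sup>+y. h (x, y + t * x) \<partial>lborel) = (\<integral>\<^sup>+y. h (x, y) \<partial>lborel)"
      using nn_integral_real_affine[of "\<lambda>y. h (x, y)" 1 "t * x"] by (simp add: add.commute)
  qed
  also have "\<dots> = (\<integral>\<^sup>+z. h z \<partial>(lborel \<Otimes>\<^sub>M lborel))"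
    by (subst lborel.nn_integral_fst) simp_all
  finally show ?thesis .
qed

text \<open>A rotation by an angle other than \<open>0\<close> and \<open>\<pi>\<close> is a product of three shears, and a shear
  preserves planar Lebesgue measure by Fubini and translation invariance in one coordinate.\<close>

lemma nn_integral_rotation:
  fixes h :: "real \<times> real \<Rightarrow> ennreal"
  assumes [measurable]: "h \<in> borel_measurable (borel \<Otimes>\<^sub>M borel)"
    and cs: "c\<^sup>2 + s\<^sup>2 = 1" and "s \<noteq> 0"
  shows "(\<integral>\<^sup>+z. h (c * fst z + s * snd z, c * snd z - s * fst z) \<partial>(lborel \<Otimes>\<^sub>M lborel))
       = (\<integral>\<^sup>+z. h z \<partial>(lborel \<Otimes>\<^sub>M lborel))"
proof -
  \<comment> \<open>For \<open>c = cos \<phi>\<close> and \<open>s = sin \<phi>\<close> this is \<open>tan (\<phi> / 2)\<close>.\<close>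
  define t where "t = (1 - c) / s"
  have st: "s * t = 1 - c" using \<open>s \<noteq> 0\<close> by (simp add: t_def)
  have tt: "t * (1 + c) = s" 
    using cs \<open>s \<noteq> 0\<close> by (simp add: t_def field_simps power2_eq_square)
  have 1: "(\<integral>\<^sup>+z. h z \<partial>(lborel \<Otimes>\<^sub>M lborel)) = (\<integral>\<^sup>+z. h (fst z + t * snd z, snd z) \<partial>(lborel \<Otimes>\<^sub>M lborel))"
    by (rule nn_integral_shear_fst[symmetric]) simp
  also have "\<dots> = (\<integral>\<^sup>+z. h (fst z + t * (snd z + (-s) * fst z), snd z + (-s) * fst z) \<partial>(lborel \<Otimes>\<^sub>M lborel))"
    by (subst nn_integral_shear_snd[of "\<lambda>z. h (fst z + t * snd z, snd z)" "-s", symmetric]) simp_all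
  also have "\<dots> = (\<integral>\<^sup>+z. h ((fst z + t * snd z) + t * (snd z + (-s) * (fst z + t * snd z)), snd z + (-s) * (fst z + t * snd z)) \<partial>(lborel \<Otimes>\<^sub>M lborel))"
    by (subst nn_integral_shear_fst[of "\<lambda>z. h (fst z + t * (snd z + (-s) * fst z), snd z + (-s) * fst z)" t, symmetric]) simp_all
  also have "\<dots> = (\<integral>\<^sup>+z. h (c * fst z + s * snd z, c * snd z - s * fst z) \<partial>(lborel \<Otimes>\<^sub>M lborel))"
  proof -
    have "(x + t * y) + t * (y + (-s) * (x + t * y)) = c * x + s * y"
         "y + (-s) * (x + t * y) = c * y - s * x" for x y
    proof -
      have "(x + t * y) + t * (y + (-s) * (x + t * y)) = (1 - s * t) * x + t * (2 - s * t) * y"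
        by (simp add: algebra_simps)
      also have "\<dots> = c * x + s * y" unfolding st using tt by simp
      finally show "(x + t * y) + t * (y + (-s) * (x + t * y)) = c * x + s * y" .
      have "y + (-s) * (x + t * y) = (1 - s * t) * y - s * x" by (simp add: algebra_simps)
      then show "y + (-s) * (x + t * y) = c * y - s * x" unfolding st by simp
    qed
    then show ?thesis by (simp only:)
  qed
  finally show ?thesis by simp
qed

lemma measurable_rotation_vimage:
  assumes "B \<in> sets (borel \<Otimes>\<^sub>M borel)"
  shows "{z. (c * fst z + s * snd z, c * snd z - s * fst z) \<in> B} \<in> sets (borel \<Otimes>\<^sub>M (borel :: real measure))"
proof -
  have "(\<lambda>z. (c * fst z + s * snd z, c * snd z - s * fst z)) \<in>
      (borel \<Otimes>\<^sub>M borel) \<rightarrow>\<^sub>M (borel \<Otimes>\<^sub>M (borel :: real measure))" by measurable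
  from measurable_sets[OF this assms] show ?thesis
    by (simp add: vimage_def space_pair_measure)
qed

text \<open>The joint density depends on the point only through its Euclidean norm.\<close>

lemma std_normal_pair_rotation:
  assumes cs: "c\<^sup>2 + s\<^sup>2 = 1" and "s \<noteq> 0" and B [measurable]: "B \<in> sets (borel \<Otimes>\<^sub>M borel)"
  shows "emeasure (std_normal_distribution \<Otimes>\<^sub>M std_normal_distribution)
           {z. (c * fst z + s * snd z, c * snd z - s * fst z) \<in> B}
       = emeasure (std_normal_distribution \<Otimes>\<^sub>M std_normal_distribution) B"
proof -
  interpret N: prob_space std_normal_distribution by (rule prob_space_normal_density) simp
  let ?f = "\<lambda>z. ennreal (std_normal_density (fst z)) * ennreal (std_normal_density (snd z))"
  have NN: "std_normal_distribution \<Otimes>\<^sub>M std_normal_distribution = density (lborel \<Otimes>\<^sub>M lborel) ?f"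
    by (subst pair_measure_density) (auto simp: case_prod_unfold N.sigma_finite_measure_axioms lborel.sigma_finite_measure_axioms)
  have inv: "?f (c * fst z + s * snd z, c * snd z - s * fst z) = ?f z" for z
  proof -
    have eq: "(c * fst z + s * snd z)\<^sup>2 + (c * snd z - s * fst z)\<^sup>2 = (fst z)\<^sup>2 + (snd z)\<^sup>2"
    proof -
      have "(c * fst z + s * snd z)\<^sup>2 + (c * snd z - s * fst z)\<^sup>2 = (c\<^sup>2 + s\<^sup>2) * ((fst z)\<^sup>2 + (snd z)\<^sup>2)"
        by (simp add: power2_eq_square algebra_simps)
      then show ?thesis by (simp add: cs)
    qed
    have "std_normal_density x * std_normal_density y = exp (- (x\<^sup>2 + y\<^sup>2) / 2) / (2 * pi)" for x y
      by (simp add: std_normal_density_def exp_add[symmetric] field_simps add_divide_distrib)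
    then have "std_normal_density (c * fst z + s * snd z) * std_normal_density (c * snd z - s * fst z)
        = std_normal_density (fst z) * std_normal_density (snd z)"
      by (simp only: eq)
    then show ?thesis by (simp add: ennreal_mult'[symmetric])
  qed
  have 1: "emeasure (density (lborel \<Otimes>\<^sub>M lborel) ?f) A = (\<integral>\<^sup>+z. ?f z * indicator A z \<partial>(lborel \<Otimes>\<^sub>M lborel))"
    if "A \<in> sets (borel \<Otimes>\<^sub>M borel)" for A
    by (rule emeasure_density) (use that in \<open>auto intro!: borel_measurable_times_ennreal simp: sets_pair_measure_cong[OF sets_lborel sets_lborel]\<close>)
  have "emeasure (std_normal_distribution \<Otimes>\<^sub>M std_normal_distribution) {z. (c * fst z + s * snd z, c * snd z - s * fst z) \<in> B}
      = (\<integral>\<^sup>+z. ?f z * indicator {z. (c * fst z + s * snd z, c * snd z - s * fst z) \<in> B} z \<partial>(lborel \<Otimes>\<^sub>M lborel))"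
    unfolding NN by (rule 1) (rule measurable_rotation_vimage[OF B])
  also have "\<dots> = (\<integral>\<^sup>+z. (\<lambda>z. ?f z * indicator B z) (c * fst z + s * snd z, c * snd z - s * fst z) \<partial>(lborel \<Otimes>\<^sub>M lborel))"
    unfolding inv by (intro nn_integral_cong) (simp add: indicator_def)
  also have "\<dots> = (\<integral>\<^sup>+z. ?f z * indicator B z \<partial>(lborel \<Otimes>\<^sub>M lborel))"
    by (rule nn_integral_rotation[OF _ cs \<open>s \<noteq> 0\<close>]) measurable
  also have "\<dots> = emeasure (std_normal_distribution \<Otimes>\<^sub>M std_normal_distribution) B"
    unfolding NN by (rule 1[symmetric]) fact
  finally show ?thesis .
qed

definition iid_std_normal :: "'a measure \<Rightarrow> nat \<Rightarrow> ('a \<Rightarrow> nat \<Rightarrow> real) \<Rightarrow> bool" where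
  "iid_std_normal M n U \<longleftrightarrow>
     prob_space.indep_vars M (\<lambda>_. borel) (\<lambda>j \<omega>. U \<omega> j) {..<n} \<and>
     (\<forall>j<n. distr M borel (\<lambda>\<omega>. U \<omega> j) = std_normal_distribution)"

lemma prob_space_std_normal: "prob_space std_normal_distribution"
  by (rule prob_space_normal_density) simp

lemma (in prob_space) iid_std_normal_measurable:
  assumes "iid_std_normal M n U" "j < n"
  shows "random_variable borel (\<lambda>\<omega>. U \<omega> j)"
  using assms by (auto simp: iid_std_normal_def indep_vars_def)

text \<open>Turning independence with standard normal margins into one equation between measures allows it
  to be verified on rectangles.\<close>

lemma (in prob_space) iid_std_normal_iff_distr_PiM:
  assumes "0 < n" and rv [measurable]: "\<And>j. j < n \<Longrightarrow> random_variable borel (\<lambda>\<omega>. U \<omega> j)"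
  shows "iid_std_normal M n U \<longleftrightarrow>
    distr M (PiM {..<n} (\<lambda>_. borel)) (\<lambda>\<omega>. \<lambda>j\<in>{..<n}. U \<omega> j) = PiM {..<n} (\<lambda>_. std_normal_distribution)"
    (is "_ \<longleftrightarrow> ?D = ?N")
proof -
  have iff: "indep_vars (\<lambda>_. borel) (\<lambda>j \<omega>. U \<omega> j) {..<n} \<longleftrightarrow>
      ?D = PiM {..<n} (\<lambda>j. distr M borel (\<lambda>\<omega>. U \<omega> j))"
    using \<open>0 < n\<close> by (intro indep_vars_iff_distr_eq_PiM') (auto intro: rv)
  have marg: "distr M borel (\<lambda>\<omega>. U \<omega> j) = std_normal_distribution" if D: "?D = ?N" and j: "j < n" for j
  proof -
    have "distr M borel (\<lambda>\<omega>. U \<omega> j) = distr ?D borel (\<lambda>x. x j)"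
      using j by (subst distr_distr) (auto simp: comp_def intro!: distr_cong)
    also have "\<dots> = distr ?N std_normal_distribution (\<lambda>x. x j)"
      unfolding D by (rule distr_cong) simp_all
    also have "\<dots> = std_normal_distribution"
      using j by (intro distr_PiM_component prob_space_std_normal) auto
    finally show ?thesis .
  qed
  show ?thesis
  proof
    assume "iid_std_normal M n U"
    then show "?D = ?N" using iff
      by (auto simp: iid_std_normal_def intro!: PiM_cong)
  next
    assume D: "?D = ?N"
    then have "?D = PiM {..<n} (\<lambda>j. distr M borel (\<lambda>\<omega>. U \<omega> j))"
      using marg[OF D] by (auto intro!: PiM_cong)
    then show "iid_std_normal M n U"
      using iff marg[OF D] by (simp add: iid_std_normal_def)
  qed
qed

definition givens :: "real \<Rightarrow> real \<Rightarrow> nat \<Rightarrow> nat \<Rightarrow> (nat \<Rightarrow> real) \<Rightarrow> (nat \<Rightarrow> real)" where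
  "givens c s a b v = v(a := c * v a + s * v b, b := c * v b - s * v a)"

text \<open>The coordinates \<open>a\<close> and \<open>b\<close> are independent of the remaining ones, and the rotation does not change
  their joint law. Hence rectangles have the same probability before and after the rotation.\<close>

lemma (in prob_space) iid_std_normal_givens:
  assumes iid: "iid_std_normal M n U"
    and ab: "a < n" "b < n" "a \<noteq> b" and cs: "c\<^sup>2 + s\<^sup>2 = 1" and s: "s \<noteq> 0"
  shows "iid_std_normal M n (\<lambda>\<omega>. givens c s a b (U \<omega>))"
proof -
  let ?N = "std_normal_distribution"
  let ?V = "\<lambda>\<omega>. givens c s a b (U \<omega>)"
  define R where "R = {..<n} - {a, b}"
  note U [measurable] = iid_std_normal_measurable[OF iid]
  have a [measurable]: "random_variable borel (\<lambda>\<omega>. U \<omega> a)" and b [measurable]: "random_variable borel (\<lambda>\<omega>. U \<omega> b)"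
    using U ab by auto
  have V [measurable]: "random_variable borel (\<lambda>\<omega>. ?V \<omega> j)" if "j < n" for j
    using U[OF that] by (cases "j = b"; cases "j = a") (simp_all add: givens_def)
  have ind: "indep_vars (\<lambda>_. borel) (\<lambda>j \<omega>. U \<omega> j) {..<n}"
    and law: "\<And>j. j < n \<Longrightarrow> distr M borel (\<lambda>\<omega>. U \<omega> j) = ?N"
    using iid by (auto simp: iid_std_normal_def)
  have block: "indep_var (PiM {a, b} (\<lambda>_. borel)) (\<lambda>\<omega>. restrict (\<lambda>j. U \<omega> j) {a, b})
                  (PiM R (\<lambda>_. borel)) (\<lambda>\<omega>. restrict (\<lambda>j. U \<omega> j) R)"
    using ab by (intro indep_var_restrict[OF ind]) (auto simp: R_def)
  have "indep_var (PiM {a} (\<lambda>_. borel)) (\<lambda>\<omega>. restrict (\<lambda>j. U \<omega> j) {a})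
                  (PiM {b} (\<lambda>_. borel)) (\<lambda>\<omega>. restrict (\<lambda>j. U \<omega> j) {b})"
    using ab by (intro indep_var_restrict[OF ind]) auto
  then have "indep_var borel ((\<lambda>x. x a) \<circ> (\<lambda>\<omega>. restrict (\<lambda>j. U \<omega> j) {a}))
                  borel ((\<lambda>x. x b) \<circ> (\<lambda>\<omega>. restrict (\<lambda>j. U \<omega> j) {b}))"
    by (rule indep_var_compose) simp_all
  then have "indep_var borel (\<lambda>\<omega>. U \<omega> a) borel (\<lambda>\<omega>. U \<omega> b)"
    by (simp add: comp_def)
  then have pair: "distr M (borel \<Otimes>\<^sub>M borel) (\<lambda>\<omega>. (U \<omega> a, U \<omega> b)) = ?N \<Otimes>\<^sub>M ?N"
    unfolding indep_var_distribution_eq using law ab by simp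
  have rect: "emeasure (distr M (PiM {..<n} (\<lambda>_. borel)) (\<lambda>\<omega>. \<lambda>j\<in>{..<n}. ?V \<omega> j)) (Pi\<^sub>E {..<n} A)
            = emeasure (distr M (PiM {..<n} (\<lambda>_. borel)) (\<lambda>\<omega>. \<lambda>j\<in>{..<n}. U \<omega> j)) (Pi\<^sub>E {..<n} A)"
    if A: "\<And>j. j \<in> {..<n} \<Longrightarrow> A j \<in> sets borel" for A :: "nat \<Rightarrow> real set"
  proof -
    let ?rot = "\<lambda>z. (c * fst z + s * snd z, c * snd z - s * fst z)"
    have AB [measurable]: "A a \<in> sets borel" "A b \<in> sets borel" using A ab by auto
    have PA: "Pi\<^sub>E {..<n} A \<in> sets (PiM {..<n} (\<lambda>_. borel))"
      using A by (intro sets_PiM_I_finite) auto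
    have PR: "Pi\<^sub>E R A \<in> sets (PiM R (\<lambda>_. borel))"
      using A by (intro sets_PiM_I_finite) (auto simp: R_def)
    have B: "{z. ?rot z \<in> A a \<times> A b} \<in> sets (borel \<Otimes>\<^sub>M borel)"
      by (rule measurable_rotation_vimage) simp
    have split: "prob {\<omega>\<in>space M. (U \<omega> a, U \<omega> b) \<in> C \<and> (\<forall>j\<in>R. U \<omega> j \<in> A j)}
        = measure (?N \<Otimes>\<^sub>M ?N) C * prob ((\<lambda>\<omega>. restrict (\<lambda>j. U \<omega> j) R) -` Pi\<^sub>E R A \<inter> space M)"
      if C: "C \<in> sets (borel \<Otimes>\<^sub>M borel)" for C
    proof -
      define C' where "C' = {x \<in> space (PiM {a, b} (\<lambda>_. borel)). (x a, x b) \<in> C}"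
      have C': "C' \<in> sets (PiM {a, b} (\<lambda>_. borel))"
      proof -
        have "(\<lambda>x. (x a, x b)) \<in> PiM {a, b} (\<lambda>_. borel :: real measure) \<rightarrow>\<^sub>M (borel \<Otimes>\<^sub>M borel)" by simp
        from measurable_sets[OF this C] show ?thesis
          by (simp add: C'_def vimage_def Int_def conj_commute)
      qed
      have "prob {\<omega>\<in>space M. (U \<omega> a, U \<omega> b) \<in> C \<and> (\<forall>j\<in>R. U \<omega> j \<in> A j)}
          = prob ((\<lambda>\<omega>. (restrict (\<lambda>j. U \<omega> j) {a, b}, restrict (\<lambda>j. U \<omega> j) R)) -` (C' \<times> Pi\<^sub>E R A) \<inter> space M)"
        by (rule arg_cong[where f=prob]) (auto simp: C'_def space_PiM)
      also have "\<dots> = prob ((\<lambda>\<omega>. restrict (\<lambda>j. U \<omega> j) {a, b}) -` C' \<inter> space M) * prob ((\<lambda>\<omega>. restrict (\<lambda>j. U \<omega> j) R) -` Pi\<^sub>E R A \<inter> space M)"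
        by (rule indep_varD[OF block C' PR])
      also have "(\<lambda>\<omega>. restrict (\<lambda>j. U \<omega> j) {a, b}) -` C' \<inter> space M = (\<lambda>\<omega>. (U \<omega> a, U \<omega> b)) -` C \<inter> space M"
        by (auto simp: C'_def space_PiM)
      also have "prob ((\<lambda>\<omega>. (U \<omega> a, U \<omega> b)) -` C \<inter> space M) = measure (?N \<Otimes>\<^sub>M ?N) C"
        unfolding pair[symmetric] by (subst measure_distr) (use C in auto)
      finally show ?thesis .
    qed
    have nR: "(\<forall>j\<in>{..<n}. P j) \<longleftrightarrow> P a \<and> P b \<and> (\<forall>j\<in>R. P j)" for P
      using ab by (auto simp: R_def)
    have gR: "?V \<omega> j = U \<omega> j" if "j \<in> R" for \<omega> j
      using that by (auto simp: givens_def R_def)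
    have 1: "emeasure (distr M (PiM {..<n} (\<lambda>_. borel)) (\<lambda>\<omega>. \<lambda>j\<in>{..<n}. ?V \<omega> j)) (Pi\<^sub>E {..<n} A)
       = prob {\<omega>\<in>space M. (U \<omega> a, U \<omega> b) \<in> {z. ?rot z \<in> A a \<times> A b} \<and> (\<forall>j\<in>R. U \<omega> j \<in> A j)}"
      unfolding emeasure_eq_measure[symmetric]
    proof (subst emeasure_distr[OF _ PA])
      have "?V \<omega> a = c * U \<omega> a + s * U \<omega> b" "?V \<omega> b = c * U \<omega> b - s * U \<omega> a" for \<omega>
        using ab by (simp_all add: givens_def)
      then have "(\<forall>j\<in>{..<n}. ?V \<omega> j \<in> A j) \<longleftrightarrow>
          (U \<omega> a, U \<omega> b) \<in> {z. ?rot z \<in> A a \<times> A b} \<and> (\<forall>j\<in>R. U \<omega> j \<in> A j)" for \<omega>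
        unfolding nR using gR by simp
      then have "(\<lambda>\<omega>. \<lambda>j\<in>{..<n}. ?V \<omega> j) -` Pi\<^sub>E {..<n} A \<inter> space M =
          {\<omega>\<in>space M. (U \<omega> a, U \<omega> b) \<in> {z. ?rot z \<in> A a \<times> A b} \<and> (\<forall>j\<in>R. U \<omega> j \<in> A j)}"
        by (auto simp only: vimage_def restrict_PiE_iff mem_Collect_eq Int_iff)
      then show "emeasure M ((\<lambda>\<omega>. \<lambda>j\<in>{..<n}. ?V \<omega> j) -` Pi\<^sub>E {..<n} A \<inter> space M) = emeasure M
          {\<omega>\<in>space M. (U \<omega> a, U \<omega> b) \<in> {z. ?rot z \<in> A a \<times> A b} \<and> (\<forall>j\<in>R. U \<omega> j \<in> A j)}"
        by simp
    qed measurable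
    have 2: "emeasure (distr M (PiM {..<n} (\<lambda>_. borel)) (\<lambda>\<omega>. \<lambda>j\<in>{..<n}. U \<omega> j)) (Pi\<^sub>E {..<n} A)
       = prob {\<omega>\<in>space M. (U \<omega> a, U \<omega> b) \<in> A a \<times> A b \<and> (\<forall>j\<in>R. U \<omega> j \<in> A j)}"
      unfolding emeasure_eq_measure[symmetric]
    proof (subst emeasure_distr[OF _ PA])
      have "(\<forall>j\<in>{..<n}. U \<omega> j \<in> A j) \<longleftrightarrow> (U \<omega> a, U \<omega> b) \<in> A a \<times> A b \<and> (\<forall>j\<in>R. U \<omega> j \<in> A j)" for \<omega>
        unfolding nR by simp
      then have "(\<lambda>\<omega>. \<lambda>j\<in>{..<n}. U \<omega> j) -` Pi\<^sub>E {..<n} A \<inter> space M =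
          {\<omega>\<in>space M. (U \<omega> a, U \<omega> b) \<in> A a \<times> A b \<and> (\<forall>j\<in>R. U \<omega> j \<in> A j)}"
        by (auto simp only: vimage_def restrict_PiE_iff mem_Collect_eq Int_iff)
      then show "emeasure M ((\<lambda>\<omega>. \<lambda>j\<in>{..<n}. U \<omega> j) -` Pi\<^sub>E {..<n} A \<inter> space M) = emeasure M
          {\<omega>\<in>space M. (U \<omega> a, U \<omega> b) \<in> A a \<times> A b \<and> (\<forall>j\<in>R. U \<omega> j \<in> A j)}"
        by simp
    qed measurable
    have "measure (?N \<Otimes>\<^sub>M ?N) {z. ?rot z \<in> A a \<times> A b} = measure (?N \<Otimes>\<^sub>M ?N) (A a \<times> A b)"
      unfolding measure_def by (subst std_normal_pair_rotation[OF cs s]) auto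
    moreover have "A a \<times> A b \<in> sets (borel \<Otimes>\<^sub>M borel)" by simp
    ultimately show ?thesis unfolding 1 2 by (simp only: split B)
  qed
  interpret N: product_sigma_finite "\<lambda>_::nat. ?N"
    by (simp add: product_sigma_finite_def prob_space_imp_sigma_finite prob_space_std_normal)
  have n: "0 < n" using ab by simp
  have DU: "distr M (PiM {..<n} (\<lambda>_. borel)) (\<lambda>\<omega>. \<lambda>j\<in>{..<n}. U \<omega> j) = PiM {..<n} (\<lambda>_. ?N)"
    using iid_std_normal_iff_distr_PiM[OF n U] iid by simp
  have "distr M (PiM {..<n} (\<lambda>_. borel)) (\<lambda>\<omega>. \<lambda>j\<in>{..<n}. ?V \<omega> j) = PiM {..<n} (\<lambda>_. ?N)"
  proof (rule N.PiM_eqI)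
    show "sets (distr M (PiM {..<n} (\<lambda>_. borel)) (\<lambda>\<omega>. \<lambda>j\<in>{..<n}. ?V \<omega> j)) = sets (PiM {..<n} (\<lambda>_. ?N))"
      by (simp, rule sets_PiM_cong) simp_all
    fix A :: "nat \<Rightarrow> real set" assume A: "\<And>j. j \<in> {..<n} \<Longrightarrow> A j \<in> sets ?N"
    then show "emeasure (distr M (PiM {..<n} (\<lambda>_. borel)) (\<lambda>\<omega>. \<lambda>j\<in>{..<n}. ?V \<omega> j)) (Pi\<^sub>E {..<n} A)
        = (\<Prod>j\<in>{..<n}. emeasure ?N (A j))"
      by (subst rect, simp, unfold DU, intro N.emeasure_PiM) auto
  qed simp
  then show ?thesis using iid_std_normal_iff_distr_PiM[OF n V] by simp
qed

text \<open>Compositions of plane rotations form a class that is large enough to triangularise any matrix, and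
  whose members preserve independent standard normals by induction. The condition \<open>s \<noteq> 0\<close> is the one under which a rotation splits
  into three shears. Vectors are functions on all of \<open>nat\<close>; coordinates from \<open>n\<close> on stay fixed.\<close>

inductive_set rotations :: "nat \<Rightarrow> ((nat \<Rightarrow> real) \<Rightarrow> (nat \<Rightarrow> real)) set" for n where
  id: "(\<lambda>v. v) \<in> rotations n"
| step: "g \<in> rotations n \<Longrightarrow> a < n \<Longrightarrow> b < n \<Longrightarrow> a \<noteq> b \<Longrightarrow> c\<^sup>2 + s\<^sup>2 = 1 \<Longrightarrow> s \<noteq> 0 \<Longrightarrow>
    (\<lambda>v. givens c s a b (g v)) \<in> rotations n"

lemma rotations_comp:
  assumes "h \<in> rotations n" "g \<in> rotations n"
  shows "(\<lambda>v. h (g v)) \<in> rotations n"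
  using assms by induction (auto intro: rotations.step)

lemma (in prob_space) iid_std_normal_rotations:
  assumes "g \<in> rotations n" "iid_std_normal M n U"
  shows "iid_std_normal M n (\<lambda>\<omega>. g (U \<omega>))"
  using assms by induction (auto intro: iid_std_normal_givens)

lemma rotations_lincomb:
  assumes "g \<in> rotations n"
  shows "g (\<lambda>l. \<Sum>i\<in>I. c' i * x i l) = (\<lambda>l. \<Sum>i\<in>I. c' i * g (x i) l)"
  using assms
proof induction
  case id show ?case by simp
next
  case (step g a b c s)
  let ?v = "\<lambda>l. \<Sum>i\<in>I. c' i * g (x i) l"
  have "c * ?v a + s * ?v b = (\<Sum>i\<in>I. c' i * (c * g (x i) a + s * g (x i) b))"
    by (simp add: distrib_left sum.distrib sum_distrib_left mult.left_commute)
  moreover have "c * ?v b - s * ?v a = (\<Sum>i\<in>I. c' i * (c * g (x i) b - s * g (x i) a))"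
    by (simp add: right_diff_distrib sum_subtractf sum_distrib_left mult.left_commute)
  ultimately show ?case
    unfolding step.IH by (simp add: givens_def fun_eq_iff)
qed

lemma rotations_add:
  assumes "g \<in> rotations n"
  shows "g (\<lambda>l. x l + y l) = (\<lambda>l. g x l + g y l)"
  using assms by induction (auto simp: givens_def fun_eq_iff algebra_simps)

lemma rotations_scale:
  assumes "g \<in> rotations n"
  shows "g (\<lambda>l. c * x l) = (\<lambda>l. c * g x l)"
  using assms by induction (auto simp: givens_def fun_eq_iff algebra_simps)

lemma rotations_inner:
  assumes "g \<in> rotations n"
  shows "(\<Sum>j<n. g v j * g w j) = (\<Sum>j<n. v j * w j)"
  using assms
proof induction
  case id show ?case by simp
next
  case (step g a b c s)
  let ?R = "{..<n} - {a} - {b}"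
  have split: "(\<Sum>j<n. f j) = f a + (f b + (\<Sum>j\<in>?R. f j))" for f :: "nat \<Rightarrow> real"
    using step(2-4) by (subst sum.remove[of _ a]) (auto simp: sum.remove[of _ b])
  have "(\<Sum>j<n. givens c s a b (g v) j * givens c s a b (g w) j)
     = (c * g v a + s * g v b) * (c * g w a + s * g w b) + ((c * g v b - s * g v a) * (c * g w b - s * g w a)
        + (\<Sum>j\<in>?R. g v j * g w j))"
    unfolding split using step(4) by (auto simp: givens_def intro!: sum.cong)
  also have "(c * g v a + s * g v b) * (c * g w a + s * g w b) + ((c * g v b - s * g v a) * (c * g w b - s * g w a)
        + (\<Sum>j\<in>?R. g v j * g w j)) = (c\<^sup>2 + s\<^sup>2) * (g v a * g w a + g v b * g w b) + (\<Sum>j\<in>?R. g v j * g w j)"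
    by (simp add: power2_eq_square algebra_simps)
  also have "\<dots> = (\<Sum>j<n. g v j * g w j)" 
    unfolding split step(5) by simp
  also have "\<dots> = (\<Sum>j<n. v j * w j)" by (rule step.IH)
  finally show ?case .
qed

text \<open>Rotating coordinate \<open>d\<close> against each later coordinate in turn clears all of them. Only coordinates
  from \<open>d\<close> on are touched, so vectors supported below \<open>d\<close>, such as the columns treated earlier, survive.\<close>

lemma rotation_zeroing_tail:
  assumes "d < n" "t \<le> n"
  shows "\<exists>h\<in>rotations n. (\<forall>b. d < b \<and> b < t \<longrightarrow> h v b = 0) \<and>
           (\<forall>w. (\<forall>b. d \<le> b \<and> b < n \<longrightarrow> w b = 0) \<longrightarrow> h w = w)"
  using assms(2)
proof (induction t)
  case 0
  show ?case by (rule bexI[OF _ rotations.id]) simp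
next
  case (Suc t)
  then obtain h where h: "h \<in> rotations n" "\<And>b. d < b \<Longrightarrow> b < t \<Longrightarrow> h v b = 0"
     "\<And>w. (\<And>b. d \<le> b \<Longrightarrow> b < n \<Longrightarrow> w b = 0) \<Longrightarrow> h w = w" by force
  show ?case
  proof (cases "t \<le> d \<or> h v t = 0")
    case True
    then show ?thesis using h by (intro bexI[OF _ h(1)]) (auto simp: less_Suc_eq)
  next
    case False
    \<comment> \<open>The rotation that carries \<open>(h v d, h v t)\<close> to \<open>(q, 0)\<close>.\<close>
    define q where "q = sqrt ((h v d)\<^sup>2 + (h v t)\<^sup>2)"
    define c where "c = h v d / q"
    define s where "s = h v t / q"
    have pos: "(h v d)\<^sup>2 + (h v t)\<^sup>2 > 0" using False by (simp add: add_nonneg_pos)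
    then have q: "q > 0" "q\<^sup>2 = (h v d)\<^sup>2 + (h v t)\<^sup>2" by (auto simp: q_def)
    have "c\<^sup>2 + s\<^sup>2 = q\<^sup>2 / q\<^sup>2"
      by (simp add: c_def s_def power_divide add_divide_distrib[symmetric] q(2))
    then have cs: "c\<^sup>2 + s\<^sup>2 = 1" using q(1) by simp
    have s: "s \<noteq> 0" using False q by (simp add: s_def)
    have "(\<lambda>v. givens c s d t (h v)) \<in> rotations n"
      using h(1) assms(1) Suc.prems False cs s by (intro rotations.step) auto
    moreover have "givens c s d t (h v) b = 0" if "d < b" "b < Suc t" for b
      using that h(2)[of b] False by (auto simp: givens_def less_Suc_eq c_def s_def)
    moreover have "givens c s d t (h w) = w" if "\<forall>b. d \<le> b \<and> b < n \<longrightarrow> w b = 0" for w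
      using that h(3)[of w] False assms(1) Suc.prems by (auto simp: givens_def fun_eq_iff)
    ultimately show ?thesis
      by (intro bexI[of _ "\<lambda>v. givens c s d t (h v)"]) auto
  qed
qed

text \<open>The QR decomposition by Givens rotations, one column at a time.\<close>

lemma rotation_triangularize:
  assumes "d \<le> n"
  shows "\<exists>g\<in>rotations n. \<forall>j<d. \<forall>b. j < b \<and> b < n \<longrightarrow> g (x j) b = 0"
  using assms
proof (induction d)
  case 0
  show ?case by (rule bexI[OF _ rotations.id]) simp
next
  case (Suc d)
  then obtain g where g: "g \<in> rotations n" "\<And>j b. j < d \<Longrightarrow> j < b \<Longrightarrow> b < n \<Longrightarrow> g (x j) b = 0"
    by force
  obtain h where h: "h \<in> rotations n" "\<And>b. d < b \<Longrightarrow> b < n \<Longrightarrow> h (g (x d)) b = 0"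
     "\<And>w. (\<And>b. d \<le> b \<Longrightarrow> b < n \<Longrightarrow> w b = 0) \<Longrightarrow> h w = w"
    using rotation_zeroing_tail[of d n n "g (x d)"] Suc.prems by force
  have "h (g (x j)) = g (x j)" if "j < d" for j
    using that g(2)[of j] by (intro h(3)) auto
  then show ?case using g h(2)
    by (intro bexI[OF _ rotations_comp[OF h(1) g(1)]]) (auto simp: less_Suc_eq)
qed

section \<open>Chi-square and scaled chi distributions\<close>

lemma (in prob_space) iid_std_normal_shift:
  assumes iid: "iid_std_normal M n U" and "k + m \<le> n" "0 < m"
  shows "iid_std_normal M m (\<lambda>\<omega> j. U \<omega> (k + j))"
proof -
  let ?N = "std_normal_distribution"
  have ind: "indep_vars (\<lambda>_. borel) (\<lambda>j \<omega>. U \<omega> j) {k..<k+m}"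
    by (rule indep_vars_subset[where I="{..<n}"]) (use iid assms(2) in \<open>auto simp: iid_std_normal_def\<close>)
  have rv: "random_variable borel (\<lambda>\<omega>. U \<omega> (k + j))" if "j < m" for j
    using iid_std_normal_measurable[OF iid] that assms(2) by auto
  have law: "distr M borel (\<lambda>\<omega>. U \<omega> j) = ?N" if "j < n" for j
    using iid that by (auto simp: iid_std_normal_def)
  interpret N: product_sigma_finite "\<lambda>_::nat. ?N"
    by (simp add: product_sigma_finite_def prob_space_imp_sigma_finite prob_space_std_normal)
  have "distr M (PiM {..<m} (\<lambda>_. borel)) (\<lambda>\<omega>. \<lambda>j\<in>{..<m}. U \<omega> (k + j)) = PiM {..<m} (\<lambda>_. ?N)"
  proof (rule N.PiM_eqI)
    show "sets (distr M (PiM {..<m} (\<lambda>_. borel)) (\<lambda>\<omega>. \<lambda>j\<in>{..<m}. U \<omega> (k + j))) = sets (PiM {..<m} (\<lambda>_. ?N))"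
      by (simp, rule sets_PiM_cong) simp_all
    fix A :: "nat \<Rightarrow> real set" assume "\<And>j. j \<in> {..<m} \<Longrightarrow> A j \<in> sets ?N"
    then have A: "\<And>j. j \<in> {..<m} \<Longrightarrow> A j \<in> sets borel" by simp
    have im: "{k..<k+m} = (\<lambda>j. k + j) ` {..<m}"
      using image_add_atLeastLessThan[of k 0 m] by (simp add: atLeast0LessThan add.commute)
    have "emeasure (distr M (PiM {..<m} (\<lambda>_. borel)) (\<lambda>\<omega>. \<lambda>j\<in>{..<m}. U \<omega> (k + j))) (Pi\<^sub>E {..<m} A)
        = emeasure M ((\<lambda>\<omega>. \<lambda>j\<in>{..<m}. U \<omega> (k + j)) -` Pi\<^sub>E {..<m} A \<inter> space M)"
    proof (rule emeasure_distr)
      show "(\<lambda>\<omega>. \<lambda>j\<in>{..<m}. U \<omega> (k + j)) \<in> M \<rightarrow>\<^sub>M PiM {..<m} (\<lambda>_. borel)"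
        by (rule measurable_restrict) (simp add: rv)
      show "Pi\<^sub>E {..<m} A \<in> sets (PiM {..<m} (\<lambda>_. borel))"
        by (rule sets_PiM_I_finite) (simp_all add: A)
    qed
    also have "\<dots> = prob (\<Inter>j\<in>{k..<k+m}. (\<lambda>\<omega>. U \<omega> j) -` A (j - k) \<inter> space M)"
    proof -
      have "(\<lambda>\<omega>. \<lambda>j\<in>{..<m}. U \<omega> (k + j)) -` Pi\<^sub>E {..<m} A \<inter> space M
          = (\<Inter>j\<in>{..<m}. (\<lambda>\<omega>. U \<omega> (k + j)) -` A j \<inter> space M)"
        using \<open>0 < m\<close> unfolding set_eq_iff Int_iff INT_iff vimage_eq restrict_PiE_iff by blast
      then show ?thesis unfolding emeasure_eq_measure im by simp
    qed
    also have "\<dots> = (\<Prod>j\<in>{k..<k+m}. prob ((\<lambda>\<omega>. U \<omega> j) -` A (j - k) \<inter> space M))"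
    proof -
      have "A (j - k) \<in> sets borel" if "j \<in> {k..<k + m}" for j
        using that by (intro A) auto
      then show ?thesis
        using \<open>0 < m\<close> by (subst indep_varsD[OF ind, of "{k..<k + m}" "\<lambda>j. A (j - k)"]) simp_all
    qed
    also have "\<dots> = (\<Prod>j\<in>{..<m}. prob ((\<lambda>\<omega>. U \<omega> (k + j)) -` A j \<inter> space M))"
      unfolding im by (subst prod.reindex) auto
    also have "\<dots> = (\<Prod>j\<in>{..<m}. emeasure ?N (A j))"
    proof (subst prod_ennreal[symmetric], simp, intro prod.cong refl)
      fix j assume j: "j \<in> {..<m}"
      then have "emeasure ?N (A j) = emeasure (distr M borel (\<lambda>\<omega>. U \<omega> (k + j))) (A j)"
        using law assms(2) by simp
      also have "\<dots> = emeasure M ((\<lambda>\<omega>. U \<omega> (k + j)) -` A j \<inter> space M)"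
        by (rule emeasure_distr) (use rv A j in auto)
      finally show "ennreal (prob ((\<lambda>\<omega>. U \<omega> (k + j)) -` A j \<inter> space M)) = emeasure ?N (A j)"
        by (simp add: emeasure_eq_measure)
    qed
    finally show "emeasure (distr M (PiM {..<m} (\<lambda>_. borel)) (\<lambda>\<omega>. \<lambda>j\<in>{..<m}. U \<omega> (k + j))) (Pi\<^sub>E {..<m} A)
        = (\<Prod>j\<in>{..<m}. emeasure ?N (A j))" .
  qed simp
  then show ?thesis using iid_std_normal_iff_distr_PiM[OF \<open>0 < m\<close> rv] by simp
qed

lemma (in prob_space) distr_sum_squares_eq_chi_square:
  assumes iid: "iid_std_normal M m U" and "0 < m"
  shows "distr M borel (\<lambda>\<omega>. \<Sum>j<m. (U \<omega> j)\<^sup>2) = chi_square m"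
proof -
  note rv [measurable] = iid_std_normal_measurable[OF iid]
  have D: "distr M (PiM {..<m} (\<lambda>_. borel)) (\<lambda>\<omega>. \<lambda>j\<in>{..<m}. U \<omega> j) = PiM {..<m} (\<lambda>_. std_normal_distribution)"
    using iid_std_normal_iff_distr_PiM[OF \<open>0 < m\<close> rv] iid by simp
  have "chi_square m = distr (distr M (PiM {..<m} (\<lambda>_. borel)) (\<lambda>\<omega>. \<lambda>j\<in>{..<m}. U \<omega> j)) borel (\<lambda>z. \<Sum>j<m. (z j)\<^sup>2)"
    by (simp add: chi_square_def D)
  also have "\<dots> = distr M borel (\<lambda>\<omega>. \<Sum>j<m. (U \<omega> j)\<^sup>2)"
    by (subst distr_distr) (auto simp: comp_def intro!: distr_cong)
  finally show ?thesis ..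
qed

lemma prob_space_chi_square: "prob_space (chi_square m)"
  unfolding chi_square_def
  by (intro prob_space.prob_space_distr prob_space_PiM prob_space_std_normal) simp

lemma sets_chi_square [simp, measurable_cong]: "sets (chi_square m) = sets borel"
  by (simp add: chi_square_def)

lemma space_chi_square [simp]: "space (chi_square m) = UNIV"
  by (simp add: chi_square_def)

lemma AE_chi_square_nonneg: "AE x in chi_square m. 0 \<le> x"
  unfolding chi_square_def by (subst AE_distr_iff) (auto intro!: AE_I2 sum_nonneg)

text \<open>The law of \<open>\<sigma>\<^sub>h\<^sub>a\<^sub>t / \<sigma>\<close> with \<open>m\<close> degrees of freedom, whose Radon-Nikodym derivative
  defines \<open>\<rho> m\<close> on the half-line.\<close>

definition scaled_chi :: "nat \<Rightarrow> real measure" where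
  "scaled_chi m = distr (chi_square m) borel (\<lambda>x. sqrt x / sqrt (real m))"

lemma prob_space_scaled_chi: "prob_space (scaled_chi m)"
  unfolding scaled_chi_def by (intro prob_space.prob_space_distr prob_space_chi_square) simp

lemma sets_scaled_chi [simp, measurable_cong]: "sets (scaled_chi m) = sets borel"
  by (simp add: scaled_chi_def)

lemma space_scaled_chi [simp]: "space (scaled_chi m) = UNIV"
  by (simp add: scaled_chi_def)

lemma AE_scaled_chi_nonneg: "AE s in scaled_chi m. 0 \<le> s"
  unfolding scaled_chi_def using AE_chi_square_nonneg[of m] by (subst AE_distr_iff) auto

text \<open>Away from \<open>y = 0\<close> the map \<open>y \<mapsto> \<surd>(c + y\<^sup>2) / \<surd>m\<close> has two differentiable inverse branches, and
  differentiable maps send null sets to null sets.\<close>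

lemma negligible_vimage_sqrt_shift:
  fixes A :: "real set"
  assumes A: "negligible A" and m: "0 < m" and c: "0 \<le> c"
  shows "negligible {y. sqrt (c + y\<^sup>2) / sqrt m \<in> A}"
proof -
  define B where "B = A \<inter> {s. 0 \<le> s \<and> c < m * s\<^sup>2}"
  let ?h = "\<lambda>s. sqrt (m * s\<^sup>2 - c)"
  have "negligible B" by (rule negligible_subset[OF A]) (auto simp: B_def)
  have diff: "?h differentiable_on B"
  proof (rule differentiable_at_imp_differentiable_on)
    fix s assume "s \<in> B"
    then have "m * s\<^sup>2 - c > 0" by (simp add: B_def)
    then have "(?h has_real_derivative (inverse (sqrt (m * s\<^sup>2 - c)) / 2) * (m * (2 * s))) (at s)"
      by (intro DERIV_chain2[where g="\<lambda>s. m * s\<^sup>2 - c", OF DERIV_real_sqrt])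
         (auto intro!: derivative_eq_intros)
    then show "?h differentiable (at s)"
      unfolding has_field_derivative_def differentiable_def by blast
  qed
  have h: "negligible (?h ` B)"
    by (rule negligible_differentiable_image_negligible[OF _ \<open>negligible B\<close> diff]) simp
  have "(\<lambda>s. - ?h s) differentiable_on B" using diff by (rule differentiable_on_minus)
  then have h': "negligible ((\<lambda>s. - ?h s) ` B)"
    by (rule negligible_differentiable_image_negligible[OF _ \<open>negligible B\<close>, rotated]) simp
  have "{y. sqrt (c + y\<^sup>2) / sqrt m \<in> A} \<subseteq> {0} \<union> ?h ` B \<union> (\<lambda>s. - ?h s) ` B"
  proof
    fix y assume "y \<in> {y. sqrt (c + y\<^sup>2) / sqrt m \<in> A}"
    then have y: "sqrt (c + y\<^sup>2) / sqrt m \<in> A" (is "?s \<in> A") by simp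
    have s2: "m * ?s\<^sup>2 = c + y\<^sup>2" using m c by (simp add: power_divide)
    show "y \<in> {0} \<union> ?h ` B \<union> (\<lambda>s. - ?h s) ` B"
    proof (cases "y = 0")
      case False
      then have B: "?s \<in> B" using y s2 m c by (simp add: B_def)
      have "?h ?s = \<bar>y\<bar>" unfolding s2 by simp
      then have "y = ?h ?s \<or> y = - ?h ?s" by linarith
      then show ?thesis using B by blast
    qed simp
  qed
  then show ?thesis
    by (rule negligible_subset[rotated]) (use h h' in auto)
qed

lemma null_sets_lborel_imp_negligible:
  "A \<in> null_sets lborel \<Longrightarrow> negligible A"
  by (simp add: negligible_iff_null_sets null_sets_completionI)

text \<open>Integrating over one of the normal coordinates first, with the others fixed, already gives zero
  for every Lebesgue null set.\<close>

lemma absolutely_continuous_scaled_chi: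
  assumes "0 < m"
  shows "absolutely_continuous lborel (scaled_chi m)"
  unfolding absolutely_continuous_def
proof
  let ?N = "std_normal_distribution"
  interpret N: product_sigma_finite "\<lambda>_::nat. ?N"
    by (simp add: product_sigma_finite_def prob_space_imp_sigma_finite prob_space_std_normal)
  fix A :: "real set" assume A: "A \<in> null_sets lborel"
  then have [measurable]: "A \<in> sets borel" by auto
  from \<open>0 < m\<close> obtain l where l: "m = Suc l" by (cases m) auto
  have ins: "{..<m} = insert l {..<l}" by (auto simp: l)
  let ?f = "\<lambda>z. indicator A (sqrt (\<Sum>j<m. (z j)\<^sup>2) / sqrt (real m)) :: ennreal"
  have sc: "scaled_chi m = distr (PiM {..<m} (\<lambda>_. ?N)) borel (\<lambda>z. sqrt (\<Sum>j<m. (z j)\<^sup>2) / sqrt (real m))"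
    unfolding scaled_chi_def chi_square_def by (subst distr_distr) (simp_all add: comp_def)
  have "emeasure (scaled_chi m) A = (\<integral>\<^sup>+x. indicator A x \<partial>scaled_chi m)"
    by simp
  also have "\<dots> = (\<integral>\<^sup>+z. ?f z \<partial>PiM {..<m} (\<lambda>_. ?N))"
    unfolding sc by (rule nn_integral_distr) simp_all
  also have "\<dots> = (\<integral>\<^sup>+z. (\<integral>\<^sup>+y. ?f (z(l := y)) \<partial>?N) \<partial>PiM {..<l} (\<lambda>_. ?N))"
    unfolding ins by (rule N.product_nn_integral_insert) (auto simp: ins[symmetric])
  also have "\<dots> = 0"
  proof -
    have "(\<integral>\<^sup>+y. ?f (z(l := y)) \<partial>?N) = 0" for z :: "nat \<Rightarrow> real"
    proof -
      define c where "c = (\<Sum>j<l. (z j)\<^sup>2)"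
      have c: "c \<ge> 0" by (simp add: c_def sum_nonneg)
      have eq: "(\<Sum>j<m. ((z(l := y)) j)\<^sup>2) = c + y\<^sup>2" for y
        by (simp add: l c_def)
      define C where "C = {y. sqrt (c + y\<^sup>2) / sqrt (real m) \<in> A}"
      have Cb: "C \<in> sets borel" unfolding C_def by measurable
      have "negligible C"
        using negligible_vimage_sqrt_shift[OF null_sets_lborel_imp_negligible[OF A] _ c, of "real m"] \<open>0 < m\<close>
        by (simp add: C_def)
      then have "C \<in> null_sets lborel"
        using Cb by (auto simp: negligible_iff_null_sets null_sets_def)
      then have "C \<in> null_sets ?N"
        using absolutely_continuousI_density[of std_normal_density lborel]
        by (auto simp: absolutely_continuous_def)
      then have "emeasure ?N C = 0" by auto
      moreover have "(\<integral>\<^sup>+y. ?f (z(l := y)) \<partial>?N) = (\<integral>\<^sup>+y. indicator C y \<partial>?N)"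
        unfolding eq by (intro nn_integral_cong) (simp add: C_def indicator_def)
      ultimately show ?thesis using Cb by (simp add: nn_integral_indicator)
    qed
    then show ?thesis by simp
  qed
  finally show "A \<in> null_sets (scaled_chi m)" by (simp add: null_sets_def)
qed

lemma measurable_\<rho> [measurable]: "\<rho> m \<in> borel_measurable borel"
  unfolding \<rho>_def by measurable

lemma \<rho>_nonneg: "0 \<le> \<rho> m s"
  by (simp add: \<rho>_def)

text \<open>The Radon-Nikodym derivative is determined only almost everywhere; cutting it off below zero and
  making it finite changes it on a null set, because the scaled chi law lives on the half-line.\<close>

lemma scaled_chi_eq_density:
  assumes "0 < m"
  shows "scaled_chi m = density lborel (\<lambda>s. ennreal (\<rho> m s))"
proof (rule measure_eqI)
  interpret S: prob_space "scaled_chi m" by (rule prob_space_scaled_chi)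
  let ?R = "RN_deriv lborel (scaled_chi m)"
  have dens: "density lborel ?R = scaled_chi m"
    using absolutely_continuous_scaled_chi[OF assms] by (intro sigma_finite_measure.density_RN_deriv[OF sigma_finite_lborel]) simp_all
  have fin: "AE s in lborel. ?R s \<noteq> \<infinity>"
    using absolutely_continuous_scaled_chi[OF assms]
    by (intro sigma_finite_measure.RN_deriv_finite[OF sigma_finite_lborel]) (simp_all add: S.sigma_finite_measure_axioms)
  fix A :: "real set" assume "A \<in> sets (scaled_chi m)"
  then have [measurable]: "A \<in> sets borel" by simp
  have "emeasure (scaled_chi m) A = emeasure (scaled_chi m) (A \<inter> {0..})"
    by (rule emeasure_eq_AE) (use AE_scaled_chi_nonneg[of m] in auto)
  also have "\<dots> = (\<integral>\<^sup>+s. ?R s * indicator (A \<inter> {0..}) s \<partial>lborel)"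
    by (subst dens[symmetric], subst emeasure_density) auto
  also have "\<dots> = (\<integral>\<^sup>+s. ennreal (\<rho> m s) * indicator A s \<partial>lborel)"
  proof (rule nn_integral_cong_AE, use fin in eventually_elim)
    fix s assume "?R s \<noteq> \<infinity>"
    then show "?R s * indicator (A \<inter> {0..}) s = ennreal (\<rho> m s) * indicator A s"
      by (auto simp: \<rho>_def scaled_chi_def[symmetric] indicator_def ennreal_enn2real_if)
  qed
  also have "\<dots> = emeasure (density lborel (\<lambda>s. ennreal (\<rho> m s))) A"
    by (subst emeasure_density) auto
  finally show "emeasure (scaled_chi m) A = emeasure (density lborel (\<lambda>s. ennreal (\<rho> m s))) A" .
qed simp

lemma integral_scaled_chi:
  fixes f :: "real \<Rightarrow> real"
  assumes "0 < m" and [measurable]: "f \<in> borel_measurable borel"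
  shows "(\<integral>s. f s \<partial>scaled_chi m) = (\<integral>s. f s * \<rho> m s \<partial>lborel)"
  unfolding scaled_chi_eq_density[OF \<open>0 < m\<close>]
  by (subst integral_density) (auto simp: \<rho>_nonneg mult.commute)

lemma AE_scaled_chi_neq:
  assumes "0 < m"
  shows "AE s in scaled_chi m. s \<noteq> c"
proof -
  have "{c} \<in> null_sets lborel" by (simp add: null_sets_def)
  then have "{c} \<in> null_sets (scaled_chi m)"
    using absolutely_continuous_scaled_chi[OF assms] by (auto simp: absolutely_continuous_def)
  from AE_not_in[OF this] show ?thesis by simp
qed

text \<open>The central limit theorem for \<open>z\<^sup>2 - 1\<close> with \<open>z\<close> standard normal, whose variance is
  \<open>3 - 2 + 1 = 2\<close>, on an infinite product of standard normal laws.\<close>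

lemma weak_conv_chi_square:
  "weak_conv_m (\<lambda>m. distr (chi_square m) borel (\<lambda>x. (x - real m) / sqrt (2 * real m))) std_normal_distribution"
proof -
  let ?N = "std_normal_distribution"
  define \<Omega> where "\<Omega> = PiM (UNIV :: nat set) (\<lambda>_. ?N)"
  interpret N: prob_space ?N by (rule prob_space_std_normal)
  interpret \<Omega>: prob_space \<Omega> unfolding \<Omega>_def by (intro prob_space_PiM prob_space_std_normal)
  have [measurable_cong]: "sets \<Omega> = sets (PiM UNIV (\<lambda>_. borel))"
    unfolding \<Omega>_def by (rule sets_PiM_cong) simp_all
  have coord: "distr \<Omega> borel (\<lambda>x. x j) = ?N" for j
  proof -
    have "distr \<Omega> borel (\<lambda>x. x j) = distr \<Omega> ?N (\<lambda>x. x j)" by (rule distr_cong) simp_all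
    also have "\<dots> = ?N" unfolding \<Omega>_def by (intro distr_PiM_component prob_space_std_normal) simp
    finally show ?thesis .
  qed
  have ind: "\<Omega>.indep_vars (\<lambda>_. borel) (\<lambda>j x. x j) UNIV"
  proof (subst \<Omega>.indep_vars_iff_distr_eq_PiM)
    have "distr \<Omega> (PiM UNIV (\<lambda>_. borel)) (\<lambda>x. \<lambda>i\<in>UNIV. x i) = distr \<Omega> \<Omega> (\<lambda>x. x)"
      by (rule distr_cong) (simp_all add: \<Omega>_def restrict_UNIV sets_PiM_cong[of UNIV UNIV "\<lambda>_. borel" "\<lambda>_. ?N"])
    then show "distr \<Omega> (PiM UNIV (\<lambda>_. borel)) (\<lambda>x. \<lambda>i\<in>UNIV. x i) = PiM UNIV (\<lambda>i. distr \<Omega> borel (\<lambda>x. x i))"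
      by (simp add: coord, simp add: \<Omega>_def)
  qed simp_all
  let ?X = "\<lambda>j x. (x j)\<^sup>2 - 1"
  have transfer: "\<Omega>.expectation (\<lambda>x. f (x j)) = (\<integral>x. f x \<partial>?N)" if [measurable]: "f \<in> borel_measurable borel" for f :: "real \<Rightarrow> real" and j
    unfolding coord[of j, symmetric] by (subst integral_distr) auto
  have m2: "(\<integral>x. x\<^sup>2 \<partial>?N) = 1" "integrable ?N (\<lambda>x. x\<^sup>2)"
    using std_normal_distribution_even_moments[of 1] by simp_all
  have m4: "(\<integral>x. x ^ 4 \<partial>?N) = 3" "integrable ?N (\<lambda>x. x ^ 4)"
    using std_normal_distribution_even_moments[of 2] by (simp_all add: fact_numeral)
  have sq: "(x\<^sup>2 - 1)\<^sup>2 = x ^ 4 - 2 * x\<^sup>2 + 1" for x :: real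
    by (simp add: power2_eq_square power4_eq_xxxx algebra_simps)
  have mean0: "\<Omega>.expectation (?X j) = 0" for j
    by (subst transfer) (simp_all add: m2 N.prob_space[simplified])
  have sq_int: "integrable ?N (\<lambda>x. (x\<^sup>2 - 1)\<^sup>2)" unfolding sq using m2 m4 by auto
  have sqmean: "\<Omega>.expectation (\<lambda>x. (?X j x)\<^sup>2) = 2" for j
    by (subst transfer[of "\<lambda>x. (x\<^sup>2 - 1)\<^sup>2"]) (simp_all add: sq m2 m4 N.prob_space[simplified])
  have clt: "weak_conv_m (\<lambda>n. distr \<Omega> borel (\<lambda>x. (\<Sum>i<n. ?X i x) / sqrt (n * (sqrt 2)\<^sup>2))) ?N"
  proof (rule \<Omega>.central_limit_theorem_zero_mean[where \<mu> = "distr ?N borel (\<lambda>x. x\<^sup>2 - 1)"])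
    show "\<Omega>.indep_vars (\<lambda>i. borel) ?X UNIV"
      by (rule \<Omega>.indep_vars_compose2[OF ind]) simp
    show "\<Omega>.expectation (?X n) = 0" for n by (rule mean0)
    show "integrable \<Omega> (\<lambda>x. (?X n x)\<^sup>2)" for n
      using sq_int unfolding coord[of n, symmetric] by (subst (asm) integrable_distr_eq) auto
    show "\<Omega>.variance (?X n) = (sqrt 2)\<^sup>2" for n by (simp add: mean0 sqmean)
    show "distr \<Omega> borel (?X n) = distr ?N borel (\<lambda>x. x\<^sup>2 - 1)" for n
      unfolding coord[of n, symmetric] by (subst distr_distr) (auto simp: comp_def)
  qed simp
  have "distr \<Omega> borel (\<lambda>x. (\<Sum>i<n. ?X i x) / sqrt (n * (sqrt 2)\<^sup>2)) =
      distr (chi_square n) borel (\<lambda>x. (x - real n) / sqrt (2 * real n))" if "n > 0" for n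
  proof -
    have iid: "iid_std_normal \<Omega> n (\<lambda>x. x)"
      unfolding iid_std_normal_def using \<Omega>.indep_vars_subset[OF ind] coord by auto
    show ?thesis
      by (subst \<Omega>.distr_sum_squares_eq_chi_square[OF iid that, symmetric], subst distr_distr)
        (simp_all add: comp_def sum_subtractf mult.commute)
  qed
  then have "distr \<Omega> borel (\<lambda>x. (\<Sum>i<n. ?X i x) / sqrt (n * (sqrt 2)\<^sup>2)) =
      distr (chi_square n) borel (\<lambda>x. (x - real n) / sqrt (2 * real n))" for n
  proof (cases "n = 0")
    \<comment> \<open>Division by \<open>sqrt 0\<close> gives \<open>0\<close>, so both sides are the unit mass at \<open>0\<close>.\<close>
    case True
    then show ?thesis
      using prob_space.distr_const[OF prob_space_chi_square, of "0::real" borel 0] \<Omega>.distr_const[of "0::real" borel] by simp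
  qed simp
  with clt show ?thesis by simp
qed

text \<open>The law of large numbers and the central limit theorem for \<open>S\<close> in one pointwise statement: Skorohod's
  theorem makes the standardised chi-square variables \<open>W\<close> converge pointwise, and \<open>S\<close> is a smooth
  function of \<open>W\<close>, namely \<open>S\<^sup>2 = 1 + W \<surd>(2 / m)\<close>.\<close>

lemma scaled_chi_coupling:
  obtains \<Omega> :: "real measure" and S :: "nat \<Rightarrow> real \<Rightarrow> real" and T :: "real \<Rightarrow> real"
  where "prob_space \<Omega>" "\<And>m. S m \<in> borel_measurable \<Omega>" "T \<in> borel_measurable \<Omega>"
    "\<And>m. 0 < m \<Longrightarrow> distr \<Omega> borel (S m) = scaled_chi m"
    "distr \<Omega> borel T = std_normal_distribution"
    "\<And>\<omega>. \<omega> \<in> space \<Omega> \<Longrightarrow> (\<lambda>m. S m \<omega>) \<longlonglongrightarrow> 1"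
    "\<And>\<omega>. \<omega> \<in> space \<Omega> \<Longrightarrow> (\<lambda>m. sqrt (real m) * (S m \<omega> - 1)) \<longlonglongrightarrow> T \<omega> / sqrt 2"
proof -
  let ?\<mu> = "\<lambda>m. distr (chi_square m) borel (\<lambda>x. (x - real m) / sqrt (2 * real m))"
  have "real_distribution (?\<mu> m)" for m
  proof -
    interpret C: prob_space "chi_square m" by (rule prob_space_chi_square)
    show ?thesis by (rule C.real_distribution_distr) simp
  qed
  moreover have "real_distribution std_normal_distribution" by (rule real_dist_normal_dist)
  ultimately obtain \<Omega> :: "real measure" and W T where \<Omega>: "prob_space \<Omega>"
    and W [measurable]: "\<And>m. W m \<in> borel_measurable \<Omega>"
    and law: "\<And>m. distr \<Omega> borel (W m) = ?\<mu> m"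
    and T: "T \<in> measurable \<Omega> lborel" and lawT: "distr \<Omega> borel T = std_normal_distribution"
    and lim: "\<And>\<omega>. \<omega> \<in> space \<Omega> \<Longrightarrow> (\<lambda>m. W m \<omega>) \<longlonglongrightarrow> T \<omega>"
    using Skorohod[OF _ _ weak_conv_chi_square] by metis
  define S where "S m \<omega> = sqrt (1 + W m \<omega> * sqrt (2 / real m))" for m \<omega>
  show ?thesis
  proof
    show "prob_space \<Omega>" by fact
    show [measurable]: "S m \<in> borel_measurable \<Omega>" for m unfolding S_def by measurable
    show "T \<in> borel_measurable \<Omega>" using T by simp
    show "distr \<Omega> borel T = std_normal_distribution" by fact
    show "distr \<Omega> borel (S m) = scaled_chi m" if "0 < m" for m
    proof -
      have "distr \<Omega> borel (S m) = distr (distr \<Omega> borel (W m)) borel (\<lambda>w. sqrt (1 + w * sqrt (2 / real m)))"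
        by (subst distr_distr) (auto simp: comp_def S_def[abs_def])
      also have "\<dots> = distr (chi_square m) borel (\<lambda>x. sqrt (1 + (x - real m) / sqrt (2 * real m) * sqrt (2 / real m)))"
        unfolding law by (subst distr_distr) (auto simp: comp_def)
      also have "(\<lambda>x. sqrt (1 + (x - real m) / sqrt (2 * real m) * sqrt (2 / real m))) = (\<lambda>x. sqrt x / sqrt (real m))"
      proof
        fix x
        have "sqrt (2 * real m) = sqrt 2 * sqrt (real m)" "sqrt (2 / real m) = sqrt 2 / sqrt (real m)"
          by (simp_all add: real_sqrt_mult real_sqrt_divide)
        then have "(x - real m) / sqrt (2 * real m) * sqrt (2 / real m) = (x - real m) / real m"
          using that by simp
        also have "\<dots> = x / real m - 1" using that by (simp add: diff_divide_distrib)
        finally show "sqrt (1 + (x - real m) / sqrt (2 * real m) * sqrt (2 / real m)) = sqrt x / sqrt (real m)"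
          by (simp add: real_sqrt_divide)
      qed
      finally show ?thesis by (simp add: scaled_chi_def)
    qed
    fix \<omega> assume \<omega>: "\<omega> \<in> space \<Omega>"
    have "(\<lambda>m. 2 / real m) \<longlonglongrightarrow> 0" by (rule lim_const_over_n)
    then have "(\<lambda>m. sqrt (2 / real m)) \<longlonglongrightarrow> sqrt 0" by (rule tendsto_real_sqrt)
    then have inner: "(\<lambda>m. 1 + W m \<omega> * sqrt (2 / real m)) \<longlonglongrightarrow> 1 + T \<omega> * 0"
      by (intro tendsto_intros lim[OF \<omega>]) simp
    from tendsto_real_sqrt[OF this] show S1: "(\<lambda>m. S m \<omega>) \<longlonglongrightarrow> 1" by (simp add: S_def)
    have "\<forall>\<^sub>F m in sequentially. 0 < 1 + W m \<omega> * sqrt (2 / real m)"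
      using order_tendstoD(1)[OF inner, of 0] by simp
    moreover have "\<forall>\<^sub>F m in sequentially. 0 < m" by (rule eventually_gt_at_top)
    ultimately have ev: "\<forall>\<^sub>F m in sequentially. sqrt 2 * W m \<omega> / (S m \<omega> + 1) = sqrt (real m) * (S m \<omega> - 1)"
    proof eventually_elim
      fix m :: nat assume pos: "0 < 1 + W m \<omega> * sqrt (2 / real m)" and m: "0 < m"
      \<comment> \<open>Linearising the root by \<open>S - 1 = (S\<^sup>2 - 1) / (S + 1)\<close> explains the factor \<open>\<surd>2 / 2 = 1 / \<surd>2\<close>.\<close>
      have "(S m \<omega> - 1) * (S m \<omega> + 1) = (S m \<omega>)\<^sup>2 - 1" by (simp add: algebra_simps power2_eq_square)
      also have "\<dots> = W m \<omega> * sqrt (2 / real m)" using pos by (simp add: S_def)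
      finally have "sqrt (real m) * (S m \<omega> - 1) * (S m \<omega> + 1) = sqrt (real m) * (W m \<omega> * sqrt (2 / real m))"
        by (simp add: mult.assoc)
      also have "\<dots> = sqrt 2 * W m \<omega>" using m by (simp add: real_sqrt_divide)
      finally have "sqrt (real m) * (S m \<omega> - 1) * (S m \<omega> + 1) = sqrt 2 * W m \<omega>" .
      moreover have "S m \<omega> + 1 > 0" using pos by (simp add: S_def add_pos_nonneg less_imp_le)
      ultimately show "sqrt 2 * W m \<omega> / (S m \<omega> + 1) = sqrt (real m) * (S m \<omega> - 1)"
        by (simp add: divide_eq_eq)
    qed
    have "(\<lambda>m. sqrt 2 * W m \<omega> / (S m \<omega> + 1)) \<longlonglongrightarrow> sqrt 2 * T \<omega> / (1 + 1)"
      by (rule tendsto_divide[OF tendsto_mult[OF tendsto_const lim[OF \<omega>]] tendsto_add[OF S1 tendsto_const]]) simp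
    from Lim_transform_eventually[OF this ev] have "(\<lambda>m. sqrt (real m) * (S m \<omega> - 1)) \<longlonglongrightarrow> sqrt 2 * T \<omega> / (1 + 1)" .
    moreover have "sqrt 2 * T \<omega> / (1 + 1) = T \<omega> / sqrt 2"
      by (simp add: field_simps)
    ultimately show "(\<lambda>m. sqrt (real m) * (S m \<omega> - 1)) \<longlonglongrightarrow> T \<omega> / sqrt 2" by simp
  qed
qed

section \<open>The standard normal probability of a band\<close>

abbreviation \<Phi>\<^sub>r :: "real \<Rightarrow> real" where "\<Phi>\<^sub>r \<equiv> cdf std_normal_distribution"

lemma \<Phi>_simps [simp]: "\<Phi> (ereal x) = \<Phi>\<^sub>r x" "\<Phi> \<infinity> = 1" "\<Phi> (- \<infinity>) = 0"
  by (simp_all add: \<Phi>_def flip: infinity_ereal_def MInfty_eq_minfinity)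

interpretation std_normal: real_distribution std_normal_distribution
  by (rule real_dist_normal_dist)

lemma emeasure_std_normal_singleton: "emeasure std_normal_distribution {x} = 0"
  by (subst emeasure_density) (auto simp: nn_integral_null_set null_sets_def nn_integral_0_iff_AE intro!: AE_I[where N="{x}"])

lemma measure_std_normal_singleton: "measure std_normal_distribution {x} = 0"
  using emeasure_std_normal_singleton[of x] by (simp add: measure_def)

lemma AE_std_normal_neq: "AE x in std_normal_distribution. x \<noteq> c"
  by (rule AE_I[where N="{c}"]) (auto simp: emeasure_std_normal_singleton)

lemma cdf_std_normal_bounds: "0 \<le> \<Phi>\<^sub>r x" "\<Phi>\<^sub>r x \<le> 1"
  by (simp_all add: std_normal.cdf_nonneg std_normal.cdf_bounded_prob)

lemma measurable_cdf_std_normal [measurable]: "\<Phi>\<^sub>r \<in> borel_measurable borel"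
  by (intro borel_measurable_mono monoI std_normal.cdf_nondecreasing)

lemma cdf_std_normal_minus: "\<Phi>\<^sub>r (- x) = 1 - \<Phi>\<^sub>r x"
proof -
  have D: "distr std_normal_distribution borel uminus = std_normal_distribution"
  proof -
    have "distributed std_normal_distribution lborel (\<lambda>x. x) (\<lambda>x. ennreal (normal_density 0 1 x))"
      by (auto simp: distributed_def intro!: distr_id2)
    from std_normal.normal_density_affine[OF this, of "-1" 0]
    have "distr std_normal_distribution lborel (\<lambda>x. 0 + - 1 * x) = density lborel (normal_density 0 1)"
      by (intro distributed_distr_eq_density) simp
    moreover have "distr std_normal_distribution lborel (\<lambda>x. 0 + - 1 * x) = distr std_normal_distribution borel uminus"
      by (rule distr_cong) simp_all
    ultimately show ?thesis by simp
  qed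
  have "\<Phi>\<^sub>r (- x) = measure (distr std_normal_distribution borel uminus) {..-x}"
    unfolding D by (simp add: cdf_def)
  also have "\<dots> = measure std_normal_distribution {x..}"
    by (subst measure_distr) (auto intro!: arg_cong[where f="measure _"])
  also have "{x..} = UNIV - {..<x}" by auto
  also have "measure std_normal_distribution (UNIV - {..<x}) = 1 - measure std_normal_distribution {..<x}"
    using std_normal.prob_compl[of "{..<x}"] by simp
  also have "measure std_normal_distribution {..<x} = \<Phi>\<^sub>r x"
  proof -
    have "measure std_normal_distribution {..x} = measure std_normal_distribution {..<x} + measure std_normal_distribution {x}"
      by (subst std_normal.finite_measure_Union[symmetric]) (auto intro!: arg_cong[where f="measure _"])
    then show ?thesis by (simp add: cdf_def measure_std_normal_singleton)
  qed
  finally show ?thesis .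
qed

text \<open>Continuity of the normal distribution function on the extended line; it is what lets the finite and
  infinite values of \<open>\<nu>\<close> and \<open>r\<close> be treated together.\<close>

lemma cdf_std_normal_tendsto_\<Phi>:
  assumes "((\<lambda>n. ereal (y n)) \<longlongrightarrow> L) F"
  shows "((\<lambda>n. \<Phi>\<^sub>r (y n)) \<longlongrightarrow> \<Phi> L) F"
proof (cases L)
  case (real l)
  then have "(y \<longlongrightarrow> l) F" using assms by simp
  then have "((\<lambda>n. \<Phi>\<^sub>r (y n)) \<longlongrightarrow> \<Phi>\<^sub>r l) F"
    by (rule isCont_tendsto_compose[rotated]) (simp add: std_normal.isCont_cdf measure_std_normal_singleton)
  then show ?thesis using real by simp
next
  case PInf
  then have "filterlim y at_top F" using assms by (simp add: tendsto_PInfty_eq_at_top)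
  from filterlim_compose[OF std_normal.cdf_lim_at_top_prob this] show ?thesis using PInf by simp
next
  case MInf
  then have "filterlim y at_bot F" using tendsto_uminus_ereal[OF assms]
    by (simp add: tendsto_PInfty_eq_at_top filterlim_uminus_at_top)
  from filterlim_compose[OF std_normal.cdf_lim_at_bot this] show ?thesis using MInf by simp
qed

text \<open>For \<open>x \<ge> 0\<close> this is \<open>P(\<bar>\<mu> + Z\<bar> \<le> x)\<close> with \<open>Z\<close> standard normal.\<close>

definition band_prob :: "real \<Rightarrow> real \<Rightarrow> real" where
  "band_prob \<mu> x = \<Phi>\<^sub>r (x - \<mu>) - \<Phi>\<^sub>r (- x - \<mu>)"

lemma band_prob_minus: "band_prob (- \<mu>) x = band_prob \<mu> x"
proof -
  have "band_prob (- \<mu>) x = \<Phi>\<^sub>r (x + \<mu>) - \<Phi>\<^sub>r (- (x - \<mu>))"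
    by (simp add: band_prob_def)
  also have "\<dots> = \<Phi>\<^sub>r (x - \<mu>) - \<Phi>\<^sub>r (- (x + \<mu>))"
    unfolding cdf_std_normal_minus by simp
  also have "- (x + \<mu>) = - x - \<mu>" by simp
  finally show ?thesis by (simp only: band_prob_def)
qed

lemma measurable_band_prob [measurable]: "band_prob \<mu> \<in> borel_measurable borel"
  unfolding band_prob_def by measurable

lemma abs_band_prob_le_1: "\<bar>band_prob \<mu> x\<bar> \<le> 1"
  using cdf_std_normal_bounds[of "x - \<mu>"] cdf_std_normal_bounds[of "- x - \<mu>"]
  by (simp add: band_prob_def)

lemma (in prob_space) expectation_tendsto_bounded:
  fixes f :: "nat \<Rightarrow> 'a \<Rightarrow> real"
  assumes "\<And>n. f n \<in> borel_measurable M" "g \<in> borel_measurable M"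
    and "\<And>n x. \<bar>f n x\<bar> \<le> 1" and "AE x in M. (\<lambda>n. f n x) \<longlonglongrightarrow> g x"
  shows "(\<lambda>n. expectation (f n)) \<longlonglongrightarrow> expectation g"
  by (rule integral_dominated_convergence[where w="\<lambda>_. 1"]) (use assms in auto)

text \<open>When the scale \<open>a\<close> diverges, only the sign of the limit of \<open>d\<close> matters.\<close>

lemma cdf_std_normal_scaled_tendsto:
  assumes a: "filterlim a at_top F" and d: "((\<lambda>n. ereal (d n)) \<longlongrightarrow> D) F" and "D \<noteq> 0"
  shows "((\<lambda>n. \<Phi>\<^sub>r (a n * d n)) \<longlongrightarrow> (if D > 0 then 1 else 0)) F"
proof -
  have pos: "((\<lambda>n. ereal (a n * d n)) \<longlongrightarrow> \<infinity>) F"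
    if d: "((\<lambda>n. ereal (d n)) \<longlongrightarrow> D) F" and D: "D > 0" for d D
  proof -
    obtain c where c: "0 < ereal c" "ereal c < D" using ereal_dense2[OF D] by auto
    have "\<forall>\<^sub>F n in F. ereal c < ereal (d n)" by (rule order_tendstoD(1)[OF d c(2)])
    moreover have "\<forall>\<^sub>F n in F. 0 \<le> a n" using a by (simp add: filterlim_at_top)
    ultimately have ev: "\<forall>\<^sub>F n in F. c * a n \<le> a n * d n"
    proof eventually_elim
      fix n assume "ereal c < ereal (d n)" "0 \<le> a n"
      then have "a n * c \<le> a n * d n" by (intro mult_left_mono) auto
      then show "c * a n \<le> a n * d n" by (simp add: mult.commute)
    qed
    have "filterlim (\<lambda>n. c * a n) at_top F"
      using c by (intro filterlim_tendsto_pos_mult_at_top[OF tendsto_const _ a]) auto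
    from filterlim_at_top_mono[OF this ev] have "filterlim (\<lambda>n. a n * d n) at_top F" .
    then show ?thesis by (simp add: tendsto_PInfty_eq_at_top)
  qed
  show ?thesis
  proof (cases "D > 0")
    case True
    from cdf_std_normal_tendsto_\<Phi>[OF pos[OF d True]] show ?thesis using True by simp
  next
    case False
    then have "- D > 0" using \<open>D \<noteq> 0\<close> by (simp add: less_le ereal_uminus_le_reorder)
    moreover have "((\<lambda>n. ereal (- d n)) \<longlongrightarrow> - D) F"
      using tendsto_uminus_ereal[OF d] by simp
    ultimately have "((\<lambda>n. ereal (a n * - d n)) \<longlongrightarrow> \<infinity>) F" by (intro pos)
    then have "((\<lambda>n. - ereal (a n * - d n)) \<longlongrightarrow> - \<infinity>) F" by (rule tendsto_uminus_ereal)
    then have "((\<lambda>n. ereal (a n * d n)) \<longlongrightarrow> - \<infinity>) F" by simp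
    from cdf_std_normal_tendsto_\<Phi>[OF this] show ?thesis using False by simp
  qed
qed

lemma band_prob_tendsto:
  assumes \<mu>: "((\<lambda>n. ereal (\<mu> n)) \<longlongrightarrow> \<nu>) F" and x: "(x \<longlongrightarrow> l) F"
  shows "((\<lambda>n. band_prob (\<mu> n) (x n)) \<longlongrightarrow> \<Phi> (- \<nu> + ereal l) - \<Phi> (- \<nu> - ereal l)) F"
proof -
  have m: "((\<lambda>n. ereal (- \<mu> n)) \<longlongrightarrow> - \<nu>) F" using tendsto_uminus_ereal[OF \<mu>] by simp
  have "((\<lambda>n. ereal (- \<mu> n) + ereal (x n)) \<longlongrightarrow> - \<nu> + ereal l) F"
    by (rule tendsto_add_ereal_general1[OF _ m]) (use x in auto)
  also have "(\<lambda>n. ereal (- \<mu> n) + ereal (x n)) = (\<lambda>n. ereal (x n - \<mu> n))" by (simp add: fun_eq_iff)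
  finally have 1: "((\<lambda>n. ereal (x n - \<mu> n)) \<longlongrightarrow> - \<nu> + ereal l) F" .
  have "((\<lambda>n. ereal (- \<mu> n) + ereal (- x n)) \<longlongrightarrow> - \<nu> + ereal (- l)) F"
    by (rule tendsto_add_ereal_general1[OF _ m]) (use tendsto_minus[OF x] in simp_all)
  also have "(\<lambda>n. ereal (- \<mu> n) + ereal (- x n)) = (\<lambda>n. ereal (- x n - \<mu> n))" by (simp add: fun_eq_iff)
  finally have 2: "((\<lambda>n. ereal (- x n - \<mu> n)) \<longlongrightarrow> - \<nu> - ereal l) F"
    by (simp add: minus_ereal_def)
  show ?thesis
    unfolding band_prob_def by (intro tendsto_diff cdf_std_normal_tendsto_\<Phi> 1 2)
qed

text \<open>The end points are \<open>a (s - z)\<close> and \<open>- a (s + z)\<close>, with \<open>z \<rightarrow> \<zeta>\<close> and \<open>s \<rightarrow> l\<close>. They diverge in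
  opposite directions exactly if \<open>\<bar>\<zeta>\<bar> < l\<close>; if \<open>\<bar>\<zeta>\<bar> > l\<close>, both run off to the same side
  and the band loses all its mass.\<close>

lemma band_prob_scaled_tendsto:
  assumes a: "filterlim a at_top F" and z: "((\<lambda>n. ereal (z n)) \<longlongrightarrow> \<zeta>) F" and s: "(s \<longlongrightarrow> l) F"
    and l: "0 \<le> l" "\<bar>\<zeta>\<bar> \<noteq> ereal l"
  shows "((\<lambda>n. band_prob (a n * z n) (a n * s n)) \<longlongrightarrow> of_bool (\<bar>\<zeta>\<bar> < ereal l)) F"
proof -
  have m: "((\<lambda>n. ereal (- z n)) \<longlongrightarrow> - \<zeta>) F" using tendsto_uminus_ereal[OF z] by simp
  have "((\<lambda>n. ereal (- z n) + ereal (s n)) \<longlongrightarrow> - \<zeta> + ereal l) F"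
    by (rule tendsto_add_ereal_general1[OF _ m]) (use s in auto)
  moreover have "- \<zeta> + ereal l \<noteq> 0" using l by (cases \<zeta>) auto
  ultimately have 1: "((\<lambda>n. \<Phi>\<^sub>r (a n * (- z n + s n))) \<longlongrightarrow> (if - \<zeta> + ereal l > 0 then 1 else 0)) F"
    by (intro cdf_std_normal_scaled_tendsto[OF a]) simp_all
  have "((\<lambda>n. ereal (- z n) + ereal (- s n)) \<longlongrightarrow> - \<zeta> + ereal (- l)) F"
    by (rule tendsto_add_ereal_general1[OF _ m]) (use tendsto_minus[OF s] in simp_all)
  moreover have "- \<zeta> + ereal (- l) \<noteq> 0" using l by (cases \<zeta>) auto
  ultimately have 2: "((\<lambda>n. \<Phi>\<^sub>r (a n * (- z n + - s n))) \<longlongrightarrow> (if - \<zeta> + ereal (- l) > 0 then 1 else 0)) F"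
    by (intro cdf_std_normal_scaled_tendsto[OF a]) simp_all
  have "(if - \<zeta> + ereal l > 0 then 1 else 0) - (if - \<zeta> + ereal (- l) > 0 then 1 else 0) = (of_bool (\<bar>\<zeta>\<bar> < ereal l) :: real)"
    using l by (cases \<zeta>) auto
  with tendsto_diff[OF 1 2] show ?thesis
    unfolding band_prob_def by (simp add: algebra_simps)
qed

section \<open>Limits of studentized band probabilities\<close>

text \<open>This is \<open>P(\<bar>\<mu> + Z\<bar> \<le> a S)\<close> for \<open>Z\<close> standard normal and \<open>S\<close> independent of \<open>Z\<close> with the scaled chi
  law, after integrating out \<open>Z\<close> (see \<open>prob_studentized_band\<close>).\<close>

definition studentized_band_prob :: "nat \<Rightarrow> real \<Rightarrow> real \<Rightarrow> real" where
  "studentized_band_prob m \<mu> a = (\<integral>s. band_prob \<mu> (a * s) \<partial>scaled_chi m)"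

text \<open>Only \<open>\<bar>\<mu>\<bar>\<close> matters, so the case \<open>\<zeta> = -1\<close> reduces to \<open>\<zeta> = 1\<close>.\<close>

lemma studentized_band_prob_minus: "studentized_band_prob m (- \<mu>) a = studentized_band_prob m \<mu> a"
  by (simp add: studentized_band_prob_def band_prob_minus)

lemma studentized_band_prob_tendsto_fixed_dof_conservative:
  assumes "0 < m" and \<mu>: "(\<lambda>n. ereal (\<mu> n)) \<longlonglongrightarrow> \<nu>" and a: "a \<longlonglongrightarrow> l"
  shows "(\<lambda>n. studentized_band_prob m (\<mu> n) (a n)) \<longlonglongrightarrow>
    (LBINT s:{0..}. (\<Phi> (- \<nu> + ereal s * ereal l) - \<Phi> (- \<nu> - ereal s * ereal l)) * \<rho> m s)"
proof -
  interpret S: prob_space "scaled_chi m" by (rule prob_space_scaled_chi)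
  define g where "g s = \<Phi> (- \<nu> + ereal s * ereal l) - \<Phi> (- \<nu> - ereal s * ereal l)" for s
  have lim: "(\<lambda>n. band_prob (\<mu> n) (a n * s)) \<longlonglongrightarrow> g s" for s
    using band_prob_tendsto[OF \<mu> tendsto_mult[OF a tendsto_const, of s]] by (simp add: g_def mult.commute)
  have g [measurable]: "g \<in> borel_measurable borel"
    by (rule borel_measurable_LIMSEQ_real[OF lim]) measurable
  have "(\<lambda>n. studentized_band_prob m (\<mu> n) (a n)) \<longlonglongrightarrow> (\<integral>s. g s \<partial>scaled_chi m)"
    unfolding studentized_band_prob_def
    by (rule S.expectation_tendsto_bounded) (use lim abs_band_prob_le_1 in auto)
  also have "(\<integral>s. g s \<partial>scaled_chi m) = (\<integral>s. g s * \<rho> m s \<partial>lborel)"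
    by (rule integral_scaled_chi[OF \<open>0 < m\<close> g])
  also have "\<dots> = (LBINT s:{0..}. g s * \<rho> m s)"
    unfolding set_lebesgue_integral_def
    by (intro Bochner_Integration.integral_cong) (auto simp: indicator_def \<rho>_def)
  finally show ?thesis unfolding g_def .
qed

lemma tail_integral_\<rho>:
  assumes "0 < m" and A [measurable]: "A \<in> sets borel"
  shows "(LBINT s:A. \<rho> m s) = measure (scaled_chi m) A"
proof -
  have "measure (scaled_chi m) A = (\<integral>s. indicator A s \<partial>scaled_chi m)" by simp
  also have "\<dots> = (\<integral>s. indicator A s * \<rho> m s \<partial>lborel)"
    by (rule integral_scaled_chi[OF \<open>0 < m\<close>]) simp
  finally show ?thesis by (simp add: set_lebesgue_integral_def)
qed

lemma AE_scaled_chi_neq_ereal: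
  assumes "0 < m" shows "AE s in scaled_chi m. x \<noteq> ereal s"
  using AE_scaled_chi_neq[OF assms, of "real_of_ereal x"] by (rule eventually_mono) auto

lemma measure_scaled_chi_tail:
  assumes "0 < m"
  shows "measure (scaled_chi m) {s. \<bar>\<zeta>\<bar> \<le> ereal s} = measure (scaled_chi m) {s. \<bar>\<zeta>\<bar> < ereal s}"
proof -
  interpret S: prob_space "scaled_chi m" by (rule prob_space_scaled_chi)
  show ?thesis
  proof (rule S.finite_measure_eq_AE)
    show "AE s in scaled_chi m. s \<in> {s. \<bar>\<zeta>\<bar> \<le> ereal s} \<longleftrightarrow> s \<in> {s. \<bar>\<zeta>\<bar> < ereal s}"
      using AE_scaled_chi_neq_ereal[OF assms, of "\<bar>\<zeta>\<bar>"] by (rule eventually_mono) auto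
  qed simp_all
qed

text \<open>For infinite \<open>\<zeta>\<close> both sides are zero: the region of integration is empty and, as \<open>m\<close> is positive,
  the bound \<open>m \<zeta>\<^sup>2\<close> is infinite.\<close>

lemma \<rho>_tail_eq_chi_square_tail:
  assumes "0 < m"
  shows "(LBINT s:{s. \<bar>\<zeta>\<bar> \<le> ereal s}. \<rho> m s) = \<P>(x in chi_square m. ereal x > ereal (real m) * \<zeta>\<^sup>2)"
proof -
  interpret C: prob_space "chi_square m" by (rule prob_space_chi_square)
  have iff: "\<bar>\<zeta>\<bar> < ereal (sqrt x / sqrt (real m)) \<longleftrightarrow> ereal (real m) * \<zeta>\<^sup>2 < ereal x" for x
  proof (cases \<zeta>)
    case (real z)
    have "\<bar>z\<bar> < sqrt x / sqrt (real m) \<longleftrightarrow> sqrt (real m * z\<^sup>2) < sqrt x"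
      using \<open>0 < m\<close> by (simp add: pos_less_divide_eq real_sqrt_mult mult.commute)
    then show ?thesis using real by simp
  qed (use \<open>0 < m\<close> in \<open>simp_all add: power2_eq_square\<close>)
  have "(LBINT s:{s. \<bar>\<zeta>\<bar> \<le> ereal s}. \<rho> m s) = measure (scaled_chi m) {s. \<bar>\<zeta>\<bar> < ereal s}"
    using measure_scaled_chi_tail[OF \<open>0 < m\<close>] tail_integral_\<rho>[OF \<open>0 < m\<close>, of "{s. \<bar>\<zeta>\<bar> \<le> ereal s}"] by simp
  also have "\<dots> = measure (chi_square m) {x. \<bar>\<zeta>\<bar> < ereal (sqrt x / sqrt (real m))}"
    unfolding scaled_chi_def by (subst measure_distr) (auto simp: vimage_def)
  finally show ?thesis by (simp add: iff)
qed

text \<open>The integrand tends to the indicator of \<open>\<bar>\<zeta>\<bar> < s\<close> except at \<open>s = \<bar>\<zeta>\<bar>\<close>, which carries no mass.\<close>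

lemma studentized_band_prob_tendsto_fixed_dof_consistent:
  assumes "0 < m" and a: "filterlim a at_top sequentially" and z: "(\<lambda>n. ereal (z n)) \<longlonglongrightarrow> \<zeta>"
  shows "(\<lambda>n. studentized_band_prob m (a n * z n) (a n)) \<longlonglongrightarrow> (LBINT s:{s. \<bar>\<zeta>\<bar> \<le> ereal s}. \<rho> m s)"
proof -
  interpret S: prob_space "scaled_chi m" by (rule prob_space_scaled_chi)
  have lim: "AE s in scaled_chi m. (\<lambda>n. band_prob (a n * z n) (a n * s)) \<longlonglongrightarrow> indicator {s. \<bar>\<zeta>\<bar> < ereal s} s"
    using AE_scaled_chi_nonneg[of m] AE_scaled_chi_neq_ereal[OF \<open>0 < m\<close>, of "\<bar>\<zeta>\<bar>"]
  proof eventually_elim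
    fix s assume "0 \<le> s" "\<bar>\<zeta>\<bar> \<noteq> ereal s"
    from band_prob_scaled_tendsto[OF a z tendsto_const this]
    show "(\<lambda>n. band_prob (a n * z n) (a n * s)) \<longlonglongrightarrow> indicator {s. \<bar>\<zeta>\<bar> < ereal s} s"
      by (simp add: indicator_def of_bool_def)
  qed
  have "(\<lambda>n. studentized_band_prob m (a n * z n) (a n)) \<longlonglongrightarrow> (\<integral>s. indicator {s. \<bar>\<zeta>\<bar> < ereal s} s \<partial>scaled_chi m)"
    unfolding studentized_band_prob_def
    by (rule S.expectation_tendsto_bounded) (use lim abs_band_prob_le_1 in auto)
  then show ?thesis
    using measure_scaled_chi_tail[OF \<open>0 < m\<close>, of \<zeta>] tail_integral_\<rho>[OF \<open>0 < m\<close>, of "{s. \<bar>\<zeta>\<bar> \<le> ereal s}"] by simp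
qed

text \<open>All limits with growing degrees of freedom go through this lemma. On the coupled space it remains to
  find the limit of \<open>band_prob\<close> along an arbitrary deterministic sequence \<open>s\<close> that behaves like a
  path of \<open>S\<close>; the number \<open>t\<close> is the value of the normal limit of that path.\<close>

lemma studentized_band_prob_tendsto_growing_dof:
  assumes m: "filterlim m at_top sequentially"
    and G [measurable]: "G \<in> borel_measurable borel"
    and lim: "AE t in std_normal_distribution.
       \<forall>s. s \<longlonglongrightarrow> 1 \<longrightarrow> (\<lambda>n. sqrt (real (m n)) * (s n - 1)) \<longlonglongrightarrow> t / sqrt 2 \<longrightarrow>
          (\<lambda>n. band_prob (\<mu> n) (a n * s n)) \<longlonglongrightarrow> G t"
  shows "(\<lambda>n. studentized_band_prob (m n) (\<mu> n) (a n)) \<longlonglongrightarrow> (\<integral>t. G t \<partial>std_normal_distribution)"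
proof -
  obtain \<Omega> :: "real measure" and S :: "nat \<Rightarrow> real \<Rightarrow> real" and T :: "real \<Rightarrow> real"
    where \<Omega>: "prob_space \<Omega>" and S [measurable]: "\<And>m. S m \<in> borel_measurable \<Omega>" and T [measurable]: "T \<in> borel_measurable \<Omega>"
      and lawS: "\<And>m. 0 < m \<Longrightarrow> distr \<Omega> borel (S m) = scaled_chi m"
      and lawT: "distr \<Omega> borel T = std_normal_distribution"
      and S1: "\<And>\<omega>. \<omega> \<in> space \<Omega> \<Longrightarrow> (\<lambda>m. S m \<omega>) \<longlonglongrightarrow> 1"
      and S2: "\<And>\<omega>. \<omega> \<in> space \<Omega> \<Longrightarrow> (\<lambda>m. sqrt (real m) * (S m \<omega> - 1)) \<longlonglongrightarrow> T \<omega> / sqrt 2"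
    by (rule scaled_chi_coupling) blast
  interpret \<Omega>: prob_space \<Omega> by fact
  have "AE \<omega> in \<Omega>. \<forall>s. s \<longlonglongrightarrow> 1 \<longrightarrow> (\<lambda>n. sqrt (real (m n)) * (s n - 1)) \<longlonglongrightarrow> T \<omega> / sqrt 2 \<longrightarrow>
          (\<lambda>n. band_prob (\<mu> n) (a n * s n)) \<longlonglongrightarrow> G (T \<omega>)"
    by (rule AE_distrD[OF T]) (unfold lawT, rule lim)
  then have conv: "AE \<omega> in \<Omega>. (\<lambda>n. band_prob (\<mu> n) (a n * S (m n) \<omega>)) \<longlonglongrightarrow> G (T \<omega>)"
  proof (rule AE_mp, intro AE_I2 impI)
    fix \<omega> assume \<omega>: "\<omega> \<in> space \<Omega>"
      and *: "\<forall>s. s \<longlonglongrightarrow> 1 \<longrightarrow> (\<lambda>n. sqrt (real (m n)) * (s n - 1)) \<longlonglongrightarrow> T \<omega> / sqrt 2 \<longrightarrow>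
          (\<lambda>n. band_prob (\<mu> n) (a n * s n)) \<longlonglongrightarrow> G (T \<omega>)"
    show "(\<lambda>n. band_prob (\<mu> n) (a n * S (m n) \<omega>)) \<longlonglongrightarrow> G (T \<omega>)"
      using *[rule_format, of "\<lambda>n. S (m n) \<omega>"] filterlim_compose[OF S1[OF \<omega>] m] filterlim_compose[OF S2[OF \<omega>] m]
      by simp
  qed
  have "(\<lambda>n. \<Omega>.expectation (\<lambda>\<omega>. band_prob (\<mu> n) (a n * S (m n) \<omega>))) \<longlonglongrightarrow> \<Omega>.expectation (\<lambda>\<omega>. G (T \<omega>))"
    by (rule \<Omega>.expectation_tendsto_bounded) (use conv abs_band_prob_le_1 in auto)
  also have "\<Omega>.expectation (\<lambda>\<omega>. G (T \<omega>)) = (\<integral>t. G t \<partial>std_normal_distribution)"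
    unfolding lawT[symmetric] by (subst integral_distr) auto
  finally have lim': "(\<lambda>n. \<Omega>.expectation (\<lambda>\<omega>. band_prob (\<mu> n) (a n * S (m n) \<omega>))) \<longlonglongrightarrow> (\<integral>t. G t \<partial>std_normal_distribution)" .
  have "\<forall>\<^sub>F n in sequentially. 0 < m n"
    by (rule eventually_compose_filterlim[OF eventually_gt_at_top m])
  then have "\<forall>\<^sub>F n in sequentially. \<Omega>.expectation (\<lambda>\<omega>. band_prob (\<mu> n) (a n * S (m n) \<omega>)) = studentized_band_prob (m n) (\<mu> n) (a n)"
  proof eventually_elim
    fix n assume "0 < m n"
    show "\<Omega>.expectation (\<lambda>\<omega>. band_prob (\<mu> n) (a n * S (m n) \<omega>)) = studentized_band_prob (m n) (\<mu> n) (a n)"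
      unfolding studentized_band_prob_def lawS[OF \<open>0 < m n\<close>, symmetric] by (subst integral_distr) auto
  qed
  from Lim_transform_eventually[OF lim' this] show ?thesis .
qed

lemma studentized_band_prob_tendsto_growing_dof_const:
  assumes m: "filterlim m at_top sequentially"
    and lim: "\<And>s. s \<longlonglongrightarrow> 1 \<Longrightarrow> (\<lambda>n. band_prob (\<mu> n) (a n * s n)) \<longlonglongrightarrow> c"
  shows "(\<lambda>n. studentized_band_prob (m n) (\<mu> n) (a n)) \<longlonglongrightarrow> c"
  using studentized_band_prob_tendsto_growing_dof[OF m, of "\<lambda>_. c" \<mu> a] lim std_normal.prob_space by simp

lemma studentized_band_prob_tendsto_growing_dof_conservative:
  assumes m: "filterlim m at_top sequentially" and \<mu>: "(\<lambda>n. ereal (\<mu> n)) \<longlonglongrightarrow> \<nu>" and a: "a \<longlonglongrightarrow> l"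
  shows "(\<lambda>n. studentized_band_prob (m n) (\<mu> n) (a n)) \<longlonglongrightarrow> \<Phi> (- \<nu> + ereal l) - \<Phi> (- \<nu> - ereal l)"
  using band_prob_tendsto[OF \<mu> tendsto_mult[OF a]]
  by (intro studentized_band_prob_tendsto_growing_dof_const[OF m]) force

lemma studentized_band_prob_tendsto_growing_dof_consistent:
  assumes m: "filterlim m at_top sequentially" and a: "filterlim a at_top sequentially"
    and z: "(\<lambda>n. ereal (z n)) \<longlonglongrightarrow> \<zeta>" and "\<bar>\<zeta>\<bar> \<noteq> 1"
  shows "(\<lambda>n. studentized_band_prob (m n) (a n * z n) (a n)) \<longlonglongrightarrow> of_bool (\<bar>\<zeta>\<bar> < 1)"
  using band_prob_scaled_tendsto[OF a z, of _ 1] assms(4)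
  by (intro studentized_band_prob_tendsto_growing_dof_const[OF m]) (simp add: one_ereal_def)

text \<open>In the critical case the lower end point \<open>- a (s + z)\<close> tends to \<open>-\<infinity>\<close>. The upper one equals
  \<open>a (1 - z) + (a / \<surd>m) w\<close> with \<open>w = \<surd>m (s - 1)\<close>, and only the limit of \<open>w\<close> is known.\<close>

lemma studentized_band_prob_tendsto_boundary:
  assumes m: "filterlim m at_top sequentially" and a: "filterlim a at_top sequentially" and z: "z \<longlonglongrightarrow> 1"
    and G: "G \<in> borel_measurable borel"
    and lim: "AE t in std_normal_distribution. \<forall>w. w \<longlonglongrightarrow> t / sqrt 2 \<longrightarrow>
       (\<lambda>n. \<Phi>\<^sub>r (a n * (1 - z n) + a n / sqrt (real (m n)) * w n)) \<longlonglongrightarrow> G t"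
  shows "(\<lambda>n. studentized_band_prob (m n) (a n * z n) (a n)) \<longlonglongrightarrow> (\<integral>t. G t \<partial>std_normal_distribution)"
proof (rule studentized_band_prob_tendsto_growing_dof[OF m G])
  show "AE t in std_normal_distribution.
       \<forall>s. s \<longlonglongrightarrow> 1 \<longrightarrow> (\<lambda>n. sqrt (real (m n)) * (s n - 1)) \<longlonglongrightarrow> t / sqrt 2 \<longrightarrow>
          (\<lambda>n. band_prob (a n * z n) (a n * s n)) \<longlonglongrightarrow> G t"
    using lim
  proof (eventually_elim, intro allI impI)
    fix t and s :: "nat \<Rightarrow> real"
    assume G: "\<forall>w. w \<longlonglongrightarrow> t / sqrt 2 \<longrightarrow> (\<lambda>n. \<Phi>\<^sub>r (a n * (1 - z n) + a n / sqrt (real (m n)) * w n)) \<longlonglongrightarrow> G t"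
      and s: "s \<longlonglongrightarrow> 1" and w: "(\<lambda>n. sqrt (real (m n)) * (s n - 1)) \<longlonglongrightarrow> t / sqrt 2"
    have "\<forall>\<^sub>F n in sequentially. 0 < m n"
    by (rule eventually_compose_filterlim[OF eventually_gt_at_top m])
    then have ev: "\<forall>\<^sub>F n in sequentially. \<Phi>\<^sub>r (a n * (1 - z n) + a n / sqrt (real (m n)) * (sqrt (real (m n)) * (s n - 1)))
        = \<Phi>\<^sub>r (a n * s n - a n * z n)"
      by eventually_elim (simp add: algebra_simps)
    have upper: "(\<lambda>n. \<Phi>\<^sub>r (a n * s n - a n * z n)) \<longlonglongrightarrow> G t"
      by (rule Lim_transform_eventually[OF G[rule_format, OF w] ev])
    have "(\<lambda>n. ereal (- s n - z n)) \<longlonglongrightarrow> ereal (- 1 - 1)"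
      using tendsto_diff[OF tendsto_minus[OF s] z] by simp
    from cdf_std_normal_scaled_tendsto[OF a this]
    have "(\<lambda>n. \<Phi>\<^sub>r (a n * (- s n - z n))) \<longlonglongrightarrow> 0" by simp
    then have lower: "(\<lambda>n. \<Phi>\<^sub>r (- (a n * s n) - a n * z n)) \<longlonglongrightarrow> 0" by (simp add: algebra_simps)
    show "(\<lambda>n. band_prob (a n * z n) (a n * s n)) \<longlonglongrightarrow> G t"
      using tendsto_diff[OF upper lower] by (simp add: band_prob_def)
  qed
qed

lemma ereal_add_real_tendsto:
  assumes "((\<lambda>n. ereal (r n)) \<longlongrightarrow> R) F" "(y \<longlongrightarrow> c) F"
  shows "((\<lambda>n. ereal (r n + y n)) \<longlongrightarrow> ereal c + R) F"
  using tendsto_add_ereal_general2[of "ereal c" "\<lambda>n. ereal (y n)" F "\<lambda>n. ereal (r n)" R] assms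
  by (simp add: add.commute)

lemma measurable_\<Phi>_affine [measurable]: "(\<lambda>t. \<Phi> (ereal (d * t) + R)) \<in> borel_measurable borel"
  by (cases R) simp_all

text \<open>Estimating \<open>\<sigma>\<close> has no effect on the limit: the term with \<open>w\<close> vanishes.\<close>

lemma studentized_band_prob_tendsto_boundary_small:
  assumes m: "filterlim m at_top sequentially" and a: "filterlim a at_top sequentially" and z: "z \<longlonglongrightarrow> 1"
    and \<kappa>: "(\<lambda>n. a n / sqrt (real (m n))) \<longlonglongrightarrow> 0"
    and r: "(\<lambda>n. ereal (a n * (1 - z n))) \<longlonglongrightarrow> R"
  shows "(\<lambda>n. studentized_band_prob (m n) (a n * z n) (a n)) \<longlonglongrightarrow> \<Phi> R"
proof -
  have "(\<lambda>n. studentized_band_prob (m n) (a n * z n) (a n)) \<longlonglongrightarrow> (\<integral>t. \<Phi> R \<partial>std_normal_distribution)"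
  proof (rule studentized_band_prob_tendsto_boundary[OF m a z], simp, intro AE_I2 allI impI)
    fix t and w :: "nat \<Rightarrow> real" assume "w \<longlonglongrightarrow> t / sqrt 2"
    from cdf_std_normal_tendsto_\<Phi>[OF ereal_add_real_tendsto[OF r tendsto_mult[OF \<kappa> this]]]
    show "(\<lambda>n. \<Phi>\<^sub>r (a n * (1 - z n) + a n / sqrt (real (m n)) * w n)) \<longlonglongrightarrow> \<Phi> R" by simp
  qed
  then show ?thesis using std_normal.prob_space by simp
qed

text \<open>Both terms contribute: the upper end point tends to \<open>R + (\<surd>2 d) (t / \<surd>2) = R + d t\<close>.\<close>

lemma studentized_band_prob_tendsto_boundary_moderate:
  assumes m: "filterlim m at_top sequentially" and a: "filterlim a at_top sequentially" and z: "z \<longlonglongrightarrow> 1"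
    and \<kappa>: "(\<lambda>n. a n / sqrt (real (m n))) \<longlonglongrightarrow> sqrt 2 * d"
    and r: "(\<lambda>n. ereal (a n * (1 - z n))) \<longlonglongrightarrow> R"
  shows "(\<lambda>n. studentized_band_prob (m n) (a n * z n) (a n)) \<longlonglongrightarrow> (LBINT t. \<Phi> (ereal (d * t) + R) * std_normal_density t)"
proof -
  have "(\<lambda>n. studentized_band_prob (m n) (a n * z n) (a n)) \<longlonglongrightarrow> (\<integral>t. \<Phi> (ereal (d * t) + R) \<partial>std_normal_distribution)"
  proof (rule studentized_band_prob_tendsto_boundary[OF m a z], measurable, intro AE_I2 allI impI)
    fix t and w :: "nat \<Rightarrow> real" assume "w \<longlonglongrightarrow> t / sqrt 2"
    from cdf_std_normal_tendsto_\<Phi>[OF ereal_add_real_tendsto[OF r tendsto_mult[OF \<kappa> this]]]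
    show "(\<lambda>n. \<Phi>\<^sub>r (a n * (1 - z n) + a n / sqrt (real (m n)) * w n)) \<longlonglongrightarrow> \<Phi> (ereal (d * t) + R)"
      by (simp add: field_simps)
  qed
  also have "(\<integral>t. \<Phi> (ereal (d * t) + R) \<partial>std_normal_distribution) = (LBINT t. \<Phi> (ereal (d * t) + R) * std_normal_density t)"
  proof -
    have "(\<integral>t. \<Phi> (ereal (d * t) + R) \<partial>std_normal_distribution)
        = (LBINT t. std_normal_density t *\<^sub>R \<Phi> (ereal (d * t) + R))"
      by (rule integral_density) simp_all
    then show ?thesis by (simp add: mult.commute)
  qed
  finally show ?thesis .
qed

text \<open>The variability of \<open>S\<close> dominates. After division by \<open>\<kappa> = a / \<surd>m\<close> the upper end point tends to
  \<open>(R + t) / \<surd>2\<close>, whose sign decides between the limits \<open>1\<close> and \<open>0\<close>; averaging over \<open>t\<close> leaves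
  \<open>P(T > - R) = \<Phi> R\<close>.\<close>

lemma studentized_band_prob_tendsto_boundary_large:
  assumes m: "filterlim m at_top sequentially" and a: "filterlim a at_top sequentially" and z: "z \<longlonglongrightarrow> 1"
    and \<kappa>: "filterlim (\<lambda>n. a n / sqrt (real (m n))) at_top sequentially"
    and r: "(\<lambda>n. ereal (inverse (a n / sqrt (real (m n))) * (a n * (1 - z n)))) \<longlonglongrightarrow> ereal (1 / sqrt 2) * R"
  shows "(\<lambda>n. studentized_band_prob (m n) (a n * z n) (a n)) \<longlonglongrightarrow> \<Phi> R"
proof -
  define \<kappa>' where "\<kappa>' n = a n / sqrt (real (m n))" for n
  have "AE t in std_normal_distribution. ereal t \<noteq> - R"
    using AE_std_normal_neq[of "real_of_ereal (- R)"]
    by (rule eventually_mono) (cases R; auto)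
  then have lim: "AE t in std_normal_distribution. \<forall>w. w \<longlonglongrightarrow> t / sqrt 2 \<longrightarrow>
       (\<lambda>n. \<Phi>\<^sub>r (a n * (1 - z n) + a n / sqrt (real (m n)) * w n)) \<longlonglongrightarrow> indicator {t. - R < ereal t} t"
  proof (eventually_elim, intro allI impI)
    fix t and w :: "nat \<Rightarrow> real" assume t: "ereal t \<noteq> - R" and w: "w \<longlonglongrightarrow> t / sqrt 2"
    let ?D = "ereal (t / sqrt 2) + ereal (1 / sqrt 2) * R"
    have D: "?D \<noteq> 0" "0 < ?D \<longleftrightarrow> - R < ereal t"
      using t by (cases R; simp add: add_divide_distrib[symmetric] add_eq_0_iff zero_less_divide_iff; linarith)+
    have "(\<lambda>n. \<Phi>\<^sub>r (\<kappa>' n * (inverse (\<kappa>' n) * (a n * (1 - z n)) + w n))) \<longlonglongrightarrow> (if 0 < ?D then 1 else 0)"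
      using cdf_std_normal_scaled_tendsto[OF \<kappa> ereal_add_real_tendsto[OF r w] D(1)] by (simp only: \<kappa>'_def)
    moreover have "\<forall>\<^sub>F n in sequentially. 0 < \<kappa>' n"
      using \<kappa> by (simp add: filterlim_at_top_dense \<kappa>'_def)
    then have "\<forall>\<^sub>F n in sequentially. \<Phi>\<^sub>r (\<kappa>' n * (inverse (\<kappa>' n) * (a n * (1 - z n)) + w n))
        = \<Phi>\<^sub>r (a n * (1 - z n) + \<kappa>' n * w n)"
      by eventually_elim (simp add: distrib_left mult.assoc[symmetric])
    ultimately have "(\<lambda>n. \<Phi>\<^sub>r (a n * (1 - z n) + \<kappa>' n * w n)) \<longlonglongrightarrow> (if 0 < ?D then 1 else 0)"
      by (rule Lim_transform_eventually)
    then show "(\<lambda>n. \<Phi>\<^sub>r (a n * (1 - z n) + a n / sqrt (real (m n)) * w n)) \<longlonglongrightarrow> indicator {t. - R < ereal t} t"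
      unfolding D(2) \<kappa>'_def by (cases "- R < ereal t") simp_all
  qed
  have "(\<lambda>n. studentized_band_prob (m n) (a n * z n) (a n)) \<longlonglongrightarrow> (\<integral>t. indicator {t. - R < ereal t} t \<partial>std_normal_distribution)"
    by (rule studentized_band_prob_tendsto_boundary[OF m a z _ lim]) measurable
  also have "(\<integral>t. indicator {t. - R < ereal t} t \<partial>std_normal_distribution) = measure std_normal_distribution {t. - R < ereal t}"
    by simp
  also have "\<dots> = \<Phi> R"
  proof (cases R)
    case (real x)
    then have "{t. - R < ereal t} = UNIV - {..- x}" by auto
    then have "measure std_normal_distribution {t. - R < ereal t} = 1 - \<Phi>\<^sub>r (- x)"
      using std_normal.prob_compl[of "{..- x}"] by (simp add: cdf_def)
    then show ?thesis using real by (simp add: cdf_std_normal_minus)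
  qed (use std_normal.prob_space in simp_all)
  finally show ?thesis .
qed

section \<open>From the estimators to the studentized band\<close>

lemma (in prob_space) iid_std_normal_weighted_sum:
  assumes iid: "iid_std_normal M n V" and K: "K \<subseteq> {..<n}" and w: "(\<Sum>b\<in>K. (w b)\<^sup>2) = 1"
  shows "distr M borel (\<lambda>\<omega>. \<Sum>b\<in>K. w b * V \<omega> b) = std_normal_distribution"
proof -
  \<comment> \<open>A vanishing weight gives a degenerate summand without density, so such indices are dropped.\<close>
  define J where "J = {b\<in>K. w b \<noteq> 0}"
  have fin: "finite K" using K finite_subset by blast
  have J: "finite J" "J \<subseteq> K" using fin by (auto simp: J_def)
  have sumJ: "(\<Sum>b\<in>K. f b) = (\<Sum>b\<in>J. f b)" if "\<And>b. b \<in> K \<Longrightarrow> w b = 0 \<Longrightarrow> f b = 0" for f :: "nat \<Rightarrow> real"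
    by (rule sum.mono_neutral_right) (use fin that in \<open>auto simp: J_def\<close>)
  have wJ: "(\<Sum>b\<in>J. (w b)\<^sup>2) = 1" using sumJ[of "\<lambda>b. (w b)\<^sup>2"] w by simp
  then have "J \<noteq> {}" by auto
  have "indep_vars (\<lambda>_. borel) (\<lambda>b \<omega>. V \<omega> b) J"
    by (rule indep_vars_subset[where I="{..<n}"]) (use iid K J in \<open>auto simp: iid_std_normal_def\<close>)
  then have ind: "indep_vars (\<lambda>_. borel) (\<lambda>b \<omega>. w b * V \<omega> b) J"
    by (rule indep_vars_compose2) simp
  have normal: "distributed M lborel (\<lambda>\<omega>. w b * V \<omega> b) (normal_density 0 \<bar>w b\<bar>)" if "b \<in> J" for b
  proof -
    have b: "b < n" "w b \<noteq> 0" using that J K by (auto simp: J_def)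
    have "distributed M lborel (\<lambda>\<omega>. V \<omega> b) (\<lambda>x. ennreal (normal_density 0 1 x))"
    proof -
      have "distr M lborel (\<lambda>\<omega>. V \<omega> b) = distr M borel (\<lambda>\<omega>. V \<omega> b)" by (rule distr_cong) simp_all
      also have "\<dots> = std_normal_distribution" using iid b by (simp add: iid_std_normal_def)
      finally show ?thesis
        using iid_std_normal_measurable[OF iid b(1)] by (simp add: distributed_def)
    qed
    from normal_density_affine[OF this _ b(2), of 0] show ?thesis by simp
  qed
  have "distributed M lborel (\<lambda>\<omega>. \<Sum>b\<in>J. w b * V \<omega> b) (normal_density (\<Sum>b\<in>J. 0) (sqrt (\<Sum>b\<in>J. \<bar>w b\<bar>\<^sup>2)))"
    by (rule sum_indep_normal[OF J(1) \<open>J \<noteq> {}\<close> ind _ normal]) (auto simp: J_def)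
  then have "distributed M lborel (\<lambda>\<omega>. \<Sum>b\<in>J. w b * V \<omega> b) std_normal_density"
    by (simp add: wJ)
  then have "distr M lborel (\<lambda>\<omega>. \<Sum>b\<in>J. w b * V \<omega> b) = std_normal_distribution"
    by (rule distributed_distr_eq_density)
  moreover have "(\<lambda>\<omega>. \<Sum>b\<in>K. w b * V \<omega> b) = (\<lambda>\<omega>. \<Sum>b\<in>J. w b * V \<omega> b)"
    by (intro ext sumJ) simp
  moreover have "distr M borel (\<lambda>\<omega>. \<Sum>b\<in>J. w b * V \<omega> b) = distr M lborel (\<lambda>\<omega>. \<Sum>b\<in>J. w b * V \<omega> b)"
    by (rule distr_cong) simp_all
  ultimately show ?thesis by simp
qed

lemma emeasure_std_normal_band:
  assumes "0 \<le> y"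
  shows "emeasure std_normal_distribution {z. \<bar>\<mu> + z\<bar> \<le> y} = ennreal (band_prob \<mu> y)" and "0 \<le> band_prob \<mu> y"
proof -
  have band: "{z. \<bar>\<mu> + z\<bar> \<le> y} = {- y - \<mu>..y - \<mu>}" by auto
  have "measure std_normal_distribution {- y - \<mu>..y - \<mu>} = band_prob \<mu> y"
  proof -
    have "{- y - \<mu>..y - \<mu>} = {- y - \<mu>} \<union> {- y - \<mu><..y - \<mu>}" using assms by auto
    then have "measure std_normal_distribution {- y - \<mu>..y - \<mu>}
        = measure std_normal_distribution {- y - \<mu>} + measure std_normal_distribution {- y - \<mu><..y - \<mu>}"
      by (simp only:) (rule std_normal.finite_measure_Union; simp)
    also have "measure std_normal_distribution {- y - \<mu><..y - \<mu>} = band_prob \<mu> y"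
    proof (cases "y = 0")
      case False
      then show ?thesis using assms unfolding band_prob_def by (subst std_normal.cdf_diff_eq) auto
    qed (simp add: band_prob_def)
    finally show ?thesis by (simp add: measure_std_normal_singleton)
  qed
  then show "emeasure std_normal_distribution {z. \<bar>\<mu> + z\<bar> \<le> y} = ennreal (band_prob \<mu> y)" "0 \<le> band_prob \<mu> y"
    unfolding band using std_normal.emeasure_eq_measure measure_nonneg by metis+
qed

text \<open>Fubini for the joint law of \<open>(S, Z)\<close>, a product measure by independence.\<close>

lemma (in prob_space) prob_studentized_band:
  assumes ind: "indep_var borel Q borel Z"
    and Z: "distr M borel Z = std_normal_distribution" and Q: "distr M borel Q = chi_square m" and "0 \<le> a"
  shows "prob {\<omega>\<in>space M. \<bar>\<mu> + Z \<omega>\<bar> \<le> a * (sqrt (Q \<omega>) / sqrt (real m))} = studentized_band_prob m \<mu> a"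
proof -
  let ?N = "std_normal_distribution" and ?S = "\<lambda>\<omega>. sqrt (Q \<omega>) / sqrt (real m)"
  interpret S: prob_space "scaled_chi m" by (rule prob_space_scaled_chi)
  have rv [measurable]: "random_variable borel Z" "random_variable borel Q"
    using indep_var_rv1[OF ind] indep_var_rv2[OF ind] by simp_all
  have "indep_var borel ((\<lambda>x. sqrt x / sqrt (real m)) \<circ> Q) borel ((\<lambda>x. x) \<circ> Z)"
    by (rule indep_var_compose[OF ind]) simp_all
  then have ind': "indep_var borel ?S borel Z"
    by (simp add: comp_def)
  have lawS: "distr M borel ?S = scaled_chi m"
    unfolding scaled_chi_def Q[symmetric] by (subst distr_distr) (auto simp: comp_def)
  have joint: "distr M (borel \<Otimes>\<^sub>M borel) (\<lambda>\<omega>. (?S \<omega>, Z \<omega>)) = scaled_chi m \<Otimes>\<^sub>M ?N"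
    using ind' unfolding indep_var_distribution_eq lawS Z by simp
  define A where "A = {p :: real \<times> real. \<bar>\<mu> + snd p\<bar> \<le> a * fst p}"
  have A: "A \<in> sets (borel \<Otimes>\<^sub>M borel)"
  proof -
    have "{p \<in> space (borel \<Otimes>\<^sub>M borel). \<bar>\<mu> + snd p\<bar> \<le> a * fst p} \<in> sets (borel \<Otimes>\<^sub>M borel)" by measurable
    then show ?thesis by (simp add: A_def space_pair_measure)
  qed
  have "emeasure M {\<omega>\<in>space M. \<bar>\<mu> + Z \<omega>\<bar> \<le> a * ?S \<omega>} = emeasure (scaled_chi m \<Otimes>\<^sub>M ?N) A"
    unfolding joint[symmetric]
    by (subst emeasure_distr[OF _ A]) (auto simp: A_def intro!: arg_cong[where f="emeasure M"])
  also have "\<dots> = (\<integral>\<^sup>+s. emeasure ?N (Pair s -` A) \<partial>scaled_chi m)"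
    by (rule std_normal.emeasure_pair_measure_alt) (use A in simp)
  also have "\<dots> = (\<integral>\<^sup>+s. ennreal (band_prob \<mu> (a * s)) \<partial>scaled_chi m)"
    by (rule nn_integral_cong_AE, use AE_scaled_chi_nonneg[of m] in eventually_elim)
       (use \<open>0 \<le> a\<close> emeasure_std_normal_band in \<open>simp add: A_def vimage_def\<close>)
  also have "\<dots> = ennreal (studentized_band_prob m \<mu> a)"
    unfolding studentized_band_prob_def
  proof (rule nn_integral_eq_integral)
    show "integrable (scaled_chi m) (\<lambda>s. band_prob \<mu> (a * s))"
      by (rule S.integrable_const_bound[where B=1]) (simp_all add: abs_band_prob_le_1)
    show "AE s in scaled_chi m. 0 \<le> band_prob \<mu> (a * s)"
      using AE_scaled_chi_nonneg[of m] by eventually_elim (use \<open>0 \<le> a\<close> emeasure_std_normal_band in simp)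
  qed
  finally have "emeasure M {\<omega>\<in>space M. \<bar>\<mu> + Z \<omega>\<bar> \<le> a * ?S \<omega>} = ennreal (studentized_band_prob m \<mu> a)" .
  moreover have "0 \<le> studentized_band_prob m \<mu> a"
    unfolding studentized_band_prob_def
    by (rule integral_nonneg_AE, use AE_scaled_chi_nonneg[of m] in eventually_elim)
       (use \<open>0 \<le> a\<close> emeasure_std_normal_band in simp)
  ultimately show ?thesis by (simp add: measure_def)
qed

text \<open>The three estimators differ only in how they shrink the values that survive the threshold.\<close>

lemma estimator_eq_0_iff:
  assumes est: "est \<in> {hard_threshold, soft_threshold, adaptive_soft_threshold}"
    and pos: "0 \<le> \<xi> X i" "0 \<le> \<eta>"
  shows "est X i \<eta> y = 0 \<longleftrightarrow> \<bar>ls_estimator X y $ i\<bar> \<le> sigma_hat X y * \<xi> X i * \<eta>"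
proof -
  define L where "L = ls_estimator X y $ i"
  define c where "c = sigma_hat X y * \<xi> X i * \<eta>"
  have "0 \<le> sigma_hat X y"
    unfolding sigma_hat_def Let_def by (simp add: scalar_prod_def sum_nonneg)
  then have c: "0 \<le> c" using pos by (simp add: c_def)
  have sq: "(sigma_hat X y)\<^sup>2 * (\<xi> X i)\<^sup>2 * \<eta>\<^sup>2 / L\<^sup>2 = (c / \<bar>L\<bar>)\<^sup>2"
    by (simp add: c_def power_mult_distrib power_divide)
  have "adaptive_soft_threshold X i \<eta> y = 0 \<longleftrightarrow> \<bar>L\<bar> \<le> c"
  proof (cases "L = 0")
    case True
    then show ?thesis using c by (simp add: adaptive_soft_threshold_def L_def)
  next
    case False
    have "adaptive_soft_threshold X i \<eta> y = 0 \<longleftrightarrow> 1 \<le> (c / \<bar>L\<bar>)\<^sup>2"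
      using False unfolding adaptive_soft_threshold_def L_def[symmetric] sq by (auto simp: max_def)
    also have "\<dots> \<longleftrightarrow> 1 \<le> c / \<bar>L\<bar>"
      using abs_le_square_iff[of 1 "c / \<bar>L\<bar>"] c by simp
    also have "\<dots> \<longleftrightarrow> \<bar>L\<bar> \<le> c" using False by (simp add: le_divide_eq)
    finally show ?thesis .
  qed
  moreover have "hard_threshold X i \<eta> y = 0 \<longleftrightarrow> \<bar>L\<bar> \<le> c"
    using c by (auto simp: hard_threshold_def L_def[symmetric] c_def[symmetric])
  moreover have "soft_threshold X i \<eta> y = 0 \<longleftrightarrow> \<bar>L\<bar> \<le> c"
    using c by (auto simp: soft_threshold_def L_def[symmetric] c_def[symmetric] sgn_eq_0_iff max_def)
  ultimately show ?thesis using est by (auto simp: L_def c_def)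
qed

section \<open>Least squares in rotated coordinates\<close>

text \<open>Repeated columns need a separate argument, because independence is expressed for the set of columns:
  with a repetition there are fewer than \<open>k\<close> columns to span the column space.\<close>

lemma full_rank_mult_vec_eq_0:
  fixes X :: "real mat"
  assumes X: "X \<in> carrier_mat n k" and rank: "vec_space.rank n X = k"
    and v: "v \<in> carrier_vec k" "X *\<^sub>v v = 0\<^sub>v n"
  shows "v = 0\<^sub>v k"
proof (rule ccontr)
  assume nz: "v \<noteq> 0\<^sub>v k"
  interpret vec_space "TYPE(real)" n .
  show False
  proof (cases "distinct (cols X)")
    case True
    from full_rank_lin_indpt[OF X rank True] lin_depI[OF X v(1) nz v(2) True] show False by blast
  next
    case False
    obtain S where S: "maximal S (\<lambda>T. T \<subseteq> set (cols X) \<and> lin_indpt T)"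
      using maximal_exists[of "\<lambda>T. T \<subseteq> set (cols X) \<and> lin_indpt T" "card (set (cols X))" "{}"]
      by (meson List.finite_set card_mono empty_iff empty_subsetI finite_lin_indpt2 rev_finite_subset)
    have "rank X = card S" by (rule rank_card_indpt[OF X S])
    also have "\<dots> \<le> card (set (cols X))" using S by (simp add: card_mono maximal_def)
    also have "\<dots> < length (cols X)"
      using False card_distinct card_length[of "cols X"] by (metis le_neq_implies_less)
    also have "\<dots> = k" using X by simp
    finally show False using rank by simp
  qed
qed

lemma mat_inverse_eqI:
  fixes A :: "'a :: field mat"
  assumes A: "A \<in> carrier_mat k k" and C: "C \<in> carrier_mat k k" and AC: "A * C = 1\<^sub>m k"
  shows "mat_inverse A = Some C"
proof -
  have CA: "C * A = 1\<^sub>m k" by (rule mat_mult_left_right_inverse[OF A C AC])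
  have "A \<in> Units (ring_mat TYPE('a) k ())"
    using A C AC CA by (auto simp: Units_def ring_mat_def)
  then obtain D where D: "mat_inverse A = Some D"
    using mat_inverse(1)[OF A, where b="()"] by (cases "mat_inverse A") auto
  from mat_inverse(2)[OF A D] have D': "D * A = 1\<^sub>m k" "D \<in> carrier_mat k k" by auto
  have "D = D * (A * C)" unfolding AC using D' by simp
  also have "\<dots> = (D * A) * C" using D' A C by (intro assoc_mult_mat[symmetric]) auto
  also have "\<dots> = C" unfolding D' using C by simp
  finally show ?thesis using D by simp
qed

lemma gram_inverse:
  fixes X :: "real mat"
  assumes X: "X \<in> carrier_mat n k" and rank: "vec_space.rank n X = k"
  obtains B where "mat_inverse (X\<^sup>T * X) = Some B" "B \<in> carrier_mat k k"
    "X\<^sup>T * X * B = 1\<^sub>m k" "B * (X\<^sup>T * X) = 1\<^sub>m k"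
proof -
  let ?A = "X\<^sup>T * X"
  have A: "?A \<in> carrier_mat k k" using X by simp
  have "det ?A \<noteq> 0"
  proof
    assume "det ?A = 0"
    then obtain v where v: "v \<in> carrier_vec k" "v \<noteq> 0\<^sub>v k" "?A *\<^sub>v v = 0\<^sub>v k"
      using det_0_iff_vec_prod_zero[OF A] by blast
    have Xv: "X *\<^sub>v v \<in> carrier_vec n" using X v by simp
    have "(X *\<^sub>v v) \<bullet> (X *\<^sub>v v) = (X\<^sup>T *\<^sub>v (X *\<^sub>v v)) \<bullet> v"
      by (rule transpose_vec_mult_scalar[OF X v(1) Xv, symmetric])
    also have "X\<^sup>T *\<^sub>v (X *\<^sub>v v) = ?A *\<^sub>v v"
      using X v by (intro assoc_mult_mat_vec[symmetric]) auto
    finally have "(X *\<^sub>v v) \<bullet> (X *\<^sub>v v) = 0" using v by simp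
    then have "(\<Sum>l\<in>{0..<n}. (X *\<^sub>v v) $ l * (X *\<^sub>v v) $ l) = 0"
      using Xv X by (simp add: scalar_prod_def del: index_mult_mat_vec)
    then have "\<forall>l\<in>{0..<n}. (X *\<^sub>v v) $ l * (X *\<^sub>v v) $ l = 0"
      by (subst (asm) sum_nonneg_eq_0_iff) auto
    then have "X *\<^sub>v v = 0\<^sub>v n"
      using Xv X by (intro eq_vecI) auto
    from full_rank_mult_vec_eq_0[OF X rank v(1) this] v(2) show False by simp
  qed
  have unit: "?A \<in> Units (ring_mat TYPE(real) k ())" 
    using det_non_zero_imp_unit[OF A \<open>det ?A \<noteq> 0\<close>] .
  then obtain B where B: "mat_inverse ?A = Some B"
    using mat_inverse(1)[OF A, where b="()"] by (cases "mat_inverse ?A") auto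
  from mat_inverse(2)[OF A B] B show ?thesis by (intro that[of B]) auto
qed

lemma \<xi>_eq:
  fixes X :: "real mat"
  assumes X: "X \<in> carrier_mat n k" and n: "0 < n" and i: "i < k"
    and B: "B \<in> carrier_mat k k" "X\<^sup>T * X * B = 1\<^sub>m k"
  shows "\<xi> X i = sqrt (real n * B $$ (i, i))"
proof -
  let ?A = "X\<^sup>T * X" and ?S = "(1 / real n) \<cdot>\<^sub>m (X\<^sup>T * X)"
  have A: "?A \<in> carrier_mat k k" using X by simp
  have S: "?S \<in> carrier_mat k k" using A by simp
  let ?C = "real n \<cdot>\<^sub>m B"
  have C: "?C \<in> carrier_mat k k" using B by simp
  have SC: "?S * ?C = 1\<^sub>m k"
  proof -
    have "?S * ?C = (1 / real n) \<cdot>\<^sub>m (?A * ?C)" using A C by (intro mult_smult_assoc_mat) auto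
    also have "?A * ?C = real n \<cdot>\<^sub>m (?A * B)" using A B by (intro mult_smult_distrib) auto
    also have "(1 / real n) \<cdot>\<^sub>m (real n \<cdot>\<^sub>m (?A * B)) = ?A * B"
      using n by (intro eq_matI) auto
    finally show ?thesis using B by simp
  qed
  have "mat_inverse ?S = Some ?C" by (rule mat_inverse_eqI[OF S C SC])
  then show ?thesis using X B i by (simp add: \<xi>_def)
qed

lemma mult_mat_vec_nth:
  assumes "A \<in> carrier_mat p q" "v \<in> carrier_vec q" "i < p"
  shows "(A *\<^sub>v v) $ i = (\<Sum>j<q. A $$ (i, j) * v $ j)"
  using assms by (simp add: scalar_prod_def atLeast0LessThan)

text \<open>Let \<open>g\<close> triangularise \<open>X\<close>, so that rotated columns are supported on the first \<open>k\<close> coordinates.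
  The estimation error is a linear combination of inner products of \<open>u\<close> with columns, hence involves
  only these coordinates of \<open>g u\<close>. The residual is orthogonal to all columns, and the rotated
  columns span the first \<open>k\<close> coordinate directions, so its rotated version vanishes there; on the
  other coordinates it agrees with \<open>g u\<close>.\<close>

lemma full_column_rank_rotation:
  fixes X :: "real mat"
  assumes X: "X \<in> carrier_mat n k" and B: "B \<in> carrier_mat k k" and BA: "B * (X\<^sup>T * X) = 1\<^sub>m k"
    and AB: "X\<^sup>T * X * B = 1\<^sub>m k" and "k \<le> n" and i: "i < k"
  obtains g w where "g \<in> rotations n" "(\<Sum>b<k. (w b)\<^sup>2) = B $$ (i, i)" "0 < B $$ (i, i)"
    "\<And>u. u \<in> carrier_vec n \<Longrightarrow> (B *\<^sub>v (X\<^sup>T *\<^sub>v u)) $ i = (\<Sum>b<k. w b * g (vec_index u) b)"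
    "\<And>u. u \<in> carrier_vec n \<Longrightarrow>
       (u - X *\<^sub>v (B *\<^sub>v (X\<^sup>T *\<^sub>v u))) \<bullet> (u - X *\<^sub>v (B *\<^sub>v (X\<^sup>T *\<^sub>v u))) = (\<Sum>b\<in>{k..<n}. (g (vec_index u) b)\<^sup>2)"
proof -
  let ?A = "X\<^sup>T * X"
  have A: "?A \<in> carrier_mat k k" using X by simp
  define x where "x j l = X $$ (l, j)" for j l
  obtain g where g: "g \<in> rotations n" and tri: "\<And>j b. j < k \<Longrightarrow> j < b \<Longrightarrow> b < n \<Longrightarrow> g (x j) b = 0"
    using rotation_triangularize[OF \<open>k \<le> n\<close>, of x] by force
  have gx0: "g (x j) b = 0" if "j < k" "k \<le> b" "b < n" for j b
    using tri[of j b] that by simp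
  have head: "(\<Sum>b<n. g (x j) b * y b) = (\<Sum>b<k. g (x j) b * y b)" if "j < k" for j y
    using \<open>k \<le> n\<close> gx0[OF that] by (intro sum.mono_neutral_right) auto
  have inner: "(\<Sum>l<n. x j l * y l) = (\<Sum>b<k. g (x j) b * g y b)" if "j < k" for j y
    using rotations_inner[OF g, of "x j" y] head[OF that] by simp
  have XT: "(X\<^sup>T *\<^sub>v u) $ j = (\<Sum>l<n. x j l * u $ l)" if "u \<in> carrier_vec n" "j < k" for u j
    using X that by (simp add: scalar_prod_def x_def atLeast0LessThan)
  have gram: "?A $$ (j, l) = (\<Sum>b<k. g (x j) b * g (x l) b)" if "j < k" "l < k" for j l
    using X that inner[of j "x l"] by (simp add: scalar_prod_def x_def[abs_def] atLeast0LessThan)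
  define w where "w b = (\<Sum>j<k. B $$ (i, j) * g (x j) b)" for b
  have w_inner: "(\<Sum>b<k. w b * g (x l) b) = (if l = i then 1 else 0)" if "l < k" for l
  proof -
    have "(\<Sum>b<k. w b * g (x l) b) = (\<Sum>j<k. B $$ (i, j) * (\<Sum>b<k. g (x j) b * g (x l) b))"
      unfolding w_def sum_distrib_left sum_distrib_right
      by (subst sum.swap) (simp add: mult.assoc)
    also have "\<dots> = (B * ?A) $$ (i, l)"
      using B X i that by (simp add: gram[symmetric] scalar_prod_def atLeast0LessThan)
    also have "\<dots> = (if l = i then 1 else 0)" unfolding BA using i that by auto
    finally show ?thesis .
  qed
  have w2: "(\<Sum>b<k. (w b)\<^sup>2) = B $$ (i, i)"
  proof -
    have "(\<Sum>b<k. (w b)\<^sup>2) = (\<Sum>b<k. w b * (\<Sum>j<k. B $$ (i, j) * g (x j) b))"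
      by (simp add: w_def power2_eq_square)
    also have "\<dots> = (\<Sum>j<k. B $$ (i, j) * (\<Sum>b<k. w b * g (x j) b))"
      unfolding sum_distrib_left by (subst sum.swap) (simp add: mult.left_commute)
    also have "\<dots> = (\<Sum>j<k. if j = i then B $$ (i, j) else 0)"
      by (intro sum.cong) (auto simp: w_inner)
    also have "\<dots> = B $$ (i, i)" using i by simp
    finally show ?thesis .
  qed
  have pos: "0 < B $$ (i, i)"
  proof -
    have "\<exists>b<k. w b \<noteq> 0"
    proof (rule ccontr)
      assume "\<not> (\<exists>b<k. w b \<noteq> 0)"
      then have "(\<Sum>b<k. w b * g (x i) b) = 0" by simp
      with w_inner[OF i] show False by simp
    qed
    then obtain b where b: "b < k" "w b \<noteq> 0" by blast
    then have "0 < (w b)\<^sup>2" by simp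
    also have "\<dots> \<le> (\<Sum>b<k. (w b)\<^sup>2)" by (rule member_le_sum) (use b in auto)
    finally show ?thesis using w2 by simp
  qed
  have est: "(B *\<^sub>v (X\<^sup>T *\<^sub>v u)) $ i = (\<Sum>b<k. w b * g (vec_index u) b)" if u: "u \<in> carrier_vec n" for u
  proof -
    have "(B *\<^sub>v (X\<^sup>T *\<^sub>v u)) $ i = (\<Sum>j<k. B $$ (i, j) * (X\<^sup>T *\<^sub>v u) $ j)"
      using X u by (intro mult_mat_vec_nth[OF B _ i] mult_mat_vec_carrier[of _ k n]) auto
    also have "\<dots> = (\<Sum>j<k. B $$ (i, j) * (\<Sum>b<k. g (x j) b * g (vec_index u) b))"
      by (intro sum.cong refl) (simp add: XT[OF u] inner)
    also have "\<dots> = (\<Sum>b<k. w b * g (vec_index u) b)"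
      unfolding w_def sum_distrib_left sum_distrib_right
      by (subst sum.swap) (simp add: mult.assoc)
    finally show ?thesis .
  qed
  have rss: "(u - X *\<^sub>v (B *\<^sub>v (X\<^sup>T *\<^sub>v u))) \<bullet> (u - X *\<^sub>v (B *\<^sub>v (X\<^sup>T *\<^sub>v u))) = (\<Sum>b\<in>{k..<n}. (g (vec_index u) b)\<^sup>2)"
    if u: "u \<in> carrier_vec n" for u
  proof -
    define c where "c = B *\<^sub>v (X\<^sup>T *\<^sub>v u)"
    have c: "c \<in> carrier_vec k"
      using X u unfolding c_def by (intro mult_mat_vec_carrier[OF B] mult_mat_vec_carrier[of _ k n]) auto
    define r where "r = u - X *\<^sub>v c"
    have r: "r \<in> carrier_vec n"
      unfolding r_def by (intro minus_carrier_vec u mult_mat_vec_carrier[OF X c])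
    define rf where "rf l = u $ l + (\<Sum>j<k. (- c $ j) * x j l)" for l
    have r_rf: "r $ l = rf l" if "l < n" for l
      using that X u c by (simp add: r_def rf_def scalar_prod_def x_def atLeast0LessThan sum_negf mult.commute)
    have g_rf: "g rf b = g (vec_index u) b + (\<Sum>j<k. (- c $ j) * g (x j) b)" for b
    proof -
      have "g rf = (\<lambda>l. g (vec_index u) l + g (\<lambda>l. \<Sum>j<k. (- c $ j) * x j l) l)"
        unfolding rf_def[abs_def] by (rule rotations_add[OF g])
      then show ?thesis unfolding rotations_lincomb[OF g] by simp
    qed
    have "X\<^sup>T *\<^sub>v r = 0\<^sub>v k"
    proof -
      have "?A *\<^sub>v c = (?A * B) *\<^sub>v (X\<^sup>T *\<^sub>v u)"
        unfolding c_def using A B X u by (intro assoc_mult_mat_vec[symmetric]) auto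
      also have "\<dots> = X\<^sup>T *\<^sub>v u" unfolding AB using X u by simp
      finally have "X\<^sup>T *\<^sub>v (X *\<^sub>v c) = X\<^sup>T *\<^sub>v u"
        using X c assoc_mult_mat_vec[of "X\<^sup>T" k n X k c] by simp
      moreover have "X\<^sup>T *\<^sub>v r = X\<^sup>T *\<^sub>v u - X\<^sup>T *\<^sub>v (X *\<^sub>v c)"
        unfolding r_def by (rule mult_minus_distrib_mat_vec[of _ k n]) (use X u c in auto)
      ultimately show ?thesis using X u by (intro eq_vecI) auto
    qed
    then have orth: "(\<Sum>b<k. g (x j) b * g rf b) = 0" if "j < k" for j
      using XT[OF r that] that inner[OF that, of rf] r_rf by simp
    \<comment> \<open>The triangular factor: \<open>?T\<^sup>T * ?T\<close> is the Gram matrix, so \<open>?T\<close> is invertible.\<close>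
    let ?T = "mat k k (\<lambda>(b, j). g (x j) b)"
    have "det (?T\<^sup>T) \<noteq> 0"
    proof -
      have "?T\<^sup>T * ?T = ?A"
        by (rule eq_matI) (use X gram in \<open>auto simp: scalar_prod_def atLeast0LessThan\<close>)
      then have "det (?T\<^sup>T) * det ?T = det ?A"
        using det_mult[of "?T\<^sup>T" k ?T] by simp
      moreover have "det ?A * det B = 1"
        using det_mult[OF A B] AB by simp
      ultimately show ?thesis by auto
    qed
    moreover have "?T\<^sup>T *\<^sub>v vec k (g rf) = 0\<^sub>v k"
      by (rule eq_vecI) (use orth in \<open>auto simp: scalar_prod_def atLeast0LessThan\<close>)
    moreover have "?T\<^sup>T \<in> carrier_mat k k" by simp
    ultimately have "vec k (g rf) = 0\<^sub>v k"
      using det_0_iff_vec_prod_zero[of "?T\<^sup>T" k] by (metis vec_carrier)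
    then have low: "g rf b = 0" if "b < k" for b
      using that by (metis index_vec index_zero_vec(1))
    have high: "g rf b = g (vec_index u) b" if "b \<in> {k..<n}" for b
      using that gx0 by (simp add: g_rf)
    have "r \<bullet> r = (\<Sum>l<n. rf l * rf l)"
      using r r_rf by (simp add: scalar_prod_def atLeast0LessThan)
    also have "\<dots> = (\<Sum>b<n. g rf b * g rf b)" by (rule rotations_inner[OF g, symmetric])
    also have "\<dots> = (\<Sum>b\<in>{k..<n}. g rf b * g rf b)"
      using low by (intro sum.mono_neutral_right) auto
    also have "\<dots> = (\<Sum>b\<in>{k..<n}. (g (vec_index u) b)\<^sup>2)"
      using high by (simp add: power2_eq_square)
    finally show ?thesis by (simp add: r_def c_def)
  qed
  show ?thesis by (rule that[OF g w2 pos est rss])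
qed

lemma spherical_normal_imp_iid:
  assumes M: "prob_space M" and "0 < \<sigma>" and u: "spherical_normal M n \<sigma> u"
  shows "iid_std_normal M n (\<lambda>\<omega> j. u \<omega> $ j / \<sigma>)"
proof -
  interpret prob_space M by fact
  have "indep_vars (\<lambda>_. borel) (\<lambda>j \<omega>. u \<omega> $ j) {..<n}"
    using u by (simp add: spherical_normal_def)
  then have "indep_vars (\<lambda>_. borel) (\<lambda>j \<omega>. u \<omega> $ j / \<sigma>) {..<n}"
    by (rule indep_vars_compose2) simp
  moreover have "distr M borel (\<lambda>\<omega>. u \<omega> $ j / \<sigma>) = std_normal_distribution" if "j < n" for j
  proof -
    have "distributed M lborel (\<lambda>\<omega>. u \<omega> $ j) (\<lambda>x. ennreal (normal_density 0 \<sigma> x))"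
      using u that by (simp add: spherical_normal_def)
    from normal_density_affine[OF this \<open>0 < \<sigma>\<close>, of "1 / \<sigma>" 0]
    have "distributed M lborel (\<lambda>\<omega>. u \<omega> $ j / \<sigma>) std_normal_density"
      using \<open>0 < \<sigma>\<close> by simp
    then have "distr M lborel (\<lambda>\<omega>. u \<omega> $ j / \<sigma>) = std_normal_distribution"
      by (rule distributed_distr_eq_density)
    moreover have "distr M borel (\<lambda>\<omega>. u \<omega> $ j / \<sigma>) = distr M lborel (\<lambda>\<omega>. u \<omega> $ j / \<sigma>)"
      by (rule distr_cong) simp_all
    ultimately show ?thesis by simp
  qed
  ultimately show ?thesis by (simp add: iid_std_normal_def)
qed

text \<open>\<open>Z\<close> and \<open>Q\<close> are functions of disjoint blocks of coordinates.\<close>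

lemma (in prob_space) iid_std_normal_head_tail:
  assumes iid: "iid_std_normal M n V" and "k < n" and w: "(\<Sum>b<k. (w b)\<^sup>2) = 1"
  defines "Z \<equiv> \<lambda>\<omega>. \<Sum>b<k. w b * V \<omega> b" and "Q \<equiv> \<lambda>\<omega>. \<Sum>b\<in>{k..<n}. (V \<omega> b)\<^sup>2"
  shows "distr M borel Z = std_normal_distribution" "distr M borel Q = chi_square (n - k)"
    "indep_var borel Q borel Z"
proof -
  show "distr M borel Z = std_normal_distribution"
    unfolding Z_def using \<open>k < n\<close> w by (intro iid_std_normal_weighted_sum[OF iid]) auto
  have "Q = (\<lambda>\<omega>. \<Sum>j<n - k. (V \<omega> (k + j))\<^sup>2)"
  proof
    fix \<omega>
    have "{k..<n} = (\<lambda>j. k + j) ` {..<n - k}"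
      using image_add_atLeastLessThan[of k 0 "n - k"] \<open>k < n\<close> by (simp add: atLeast0LessThan)
    then show "Q \<omega> = (\<Sum>j<n - k. (V \<omega> (k + j))\<^sup>2)"
      unfolding Q_def by (simp add: sum.reindex)
  qed
  then show "distr M borel Q = chi_square (n - k)"
    using distr_sum_squares_eq_chi_square[OF iid_std_normal_shift[OF iid, of k "n - k"]] \<open>k < n\<close> by simp
  have ind: "indep_vars (\<lambda>_. borel) (\<lambda>j \<omega>. V \<omega> j) {..<n}"
    using iid by (simp add: iid_std_normal_def)
  have "indep_var (PiM {k..<n} (\<lambda>_. borel)) (\<lambda>\<omega>. restrict (\<lambda>j. V \<omega> j) {k..<n})
                  (PiM {..<k} (\<lambda>_. borel)) (\<lambda>\<omega>. restrict (\<lambda>j. V \<omega> j) {..<k})"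
    using \<open>k < n\<close> by (intro indep_var_restrict[OF ind]) auto
  then have "indep_var borel ((\<lambda>v. \<Sum>b\<in>{k..<n}. (v b)\<^sup>2) \<circ> (\<lambda>\<omega>. restrict (\<lambda>j. V \<omega> j) {k..<n}))
                  borel ((\<lambda>v. \<Sum>b<k. w b * v b) \<circ> (\<lambda>\<omega>. restrict (\<lambda>j. V \<omega> j) {..<k}))"
    by (rule indep_var_compose) simp_all
  then show "indep_var borel Q borel Z"
    by (simp add: comp_def Q_def Z_def)
qed

text \<open>The exact finite-sample distribution. In terms of the rotated errors \<open>V\<close>, scaled to unit variance, the
  least squares component is \<open>\<theta>\<^sub>i + \<sigma> \<beta> Z\<close> with \<open>\<beta> = \<xi>\<^sub>i / \<surd>n\<close>, and \<open>\<sigma>\<^sub>h\<^sub>a\<^sub>t = \<sigma> \<surd>(Q / (n - k))\<close>. The common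
  factor \<open>\<sigma> \<beta>\<close> cancels from the threshold condition.\<close>

lemma prob_estimator_eq_0:
  fixes X :: "real mat"
  assumes X: "X \<in> carrier_mat n k" and rank: "vec_space.rank n X = k" and "k < n" and i: "i < k"
    and model: "gaussian_regression X Y P" and \<theta>: "\<theta> \<in> carrier_vec k" and \<sigma>: "0 < \<sigma>" and "0 < \<eta>"
    and est: "est \<in> {hard_threshold, soft_threshold, adaptive_soft_threshold}"
  shows "\<P>(\<omega> in P \<theta> \<sigma>. est X i \<eta> (Y \<omega>) = 0)
       = studentized_band_prob (n - k) (sqrt (real n) * \<theta> $ i / (\<sigma> * \<xi> X i)) (sqrt (real n) * \<eta>)"
proof -
  obtain B where inv: "mat_inverse (X\<^sup>T * X) = Some B" and B: "B \<in> carrier_mat k k"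
    and AB: "X\<^sup>T * X * B = 1\<^sub>m k" and BA: "B * (X\<^sup>T * X) = 1\<^sub>m k"
    by (rule gram_inverse[OF X rank])
  obtain g w where g: "g \<in> rotations n" and w: "(\<Sum>b<k. (w b)\<^sup>2) = B $$ (i, i)" and pos: "0 < B $$ (i, i)"
    and estim: "\<And>u. u \<in> carrier_vec n \<Longrightarrow> (B *\<^sub>v (X\<^sup>T *\<^sub>v u)) $ i = (\<Sum>b<k. w b * g (vec_index u) b)"
    and rss: "\<And>u. u \<in> carrier_vec n \<Longrightarrow>
       (u - X *\<^sub>v (B *\<^sub>v (X\<^sup>T *\<^sub>v u))) \<bullet> (u - X *\<^sub>v (B *\<^sub>v (X\<^sup>T *\<^sub>v u))) = (\<Sum>b\<in>{k..<n}. (g (vec_index u) b)\<^sup>2)"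
    by (rule full_column_rank_rotation[OF X B BA AB less_imp_le[OF \<open>k < n\<close>] i]) blast
  let ?M = "P \<theta> \<sigma>"
  define \<beta> where "\<beta> = sqrt (B $$ (i, i))"
  have \<beta>: "0 < \<beta>" using pos by (simp add: \<beta>_def)
  have n: "0 < real n" using \<open>k < n\<close> by simp
  have \<xi>: "\<xi> X i = sqrt (real n) * \<beta>"
    using \<xi>_eq[OF X _ i B AB] \<open>k < n\<close> by (simp add: \<beta>_def real_sqrt_mult)
  then have \<xi>_pos: "0 < \<xi> X i" using \<beta> n by simp
  interpret prob_space ?M using model X \<theta> \<sigma> by (auto simp: gaussian_regression_def)
  have Y: "Y \<omega> \<in> carrier_vec n" if "\<omega> \<in> space ?M" for \<omega>
    using model X \<theta> \<sigma> that by (auto simp: gaussian_regression_def)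
  define u where "u \<omega> = Y \<omega> - X *\<^sub>v \<theta>" for \<omega>
  have "spherical_normal ?M n \<sigma> u"
    using model X \<theta> \<sigma> by (auto simp: gaussian_regression_def u_def[abs_def])
  then have "iid_std_normal ?M n (\<lambda>\<omega> j. u \<omega> $ j / \<sigma>)"
    by (rule spherical_normal_imp_iid[OF prob_space_axioms \<sigma>])
  from iid_std_normal_rotations[OF g this]
  have iid: "iid_std_normal ?M n (\<lambda>\<omega>. g (\<lambda>j. u \<omega> $ j / \<sigma>))" .
  define V where "V \<omega> = g (\<lambda>j. u \<omega> $ j / \<sigma>)" for \<omega>
  have iidV: "iid_std_normal ?M n V" using iid by (simp add: V_def[abs_def])
  have gu: "g (vec_index (u \<omega>)) b = \<sigma> * V \<omega> b" for \<omega> b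
    using rotations_scale[OF g, of \<sigma> "\<lambda>j. u \<omega> $ j / \<sigma>"] \<sigma> by (simp add: V_def)
  define Z where "Z \<omega> = (\<Sum>b<k. w b / \<beta> * V \<omega> b)" for \<omega>
  define Q where "Q \<omega> = (\<Sum>b\<in>{k..<n}. (V \<omega> b)\<^sup>2)" for \<omega>
  have "(\<Sum>b<k. (w b / \<beta>)\<^sup>2) = (\<Sum>b<k. (w b)\<^sup>2) / \<beta>\<^sup>2"
    by (simp add: power_divide sum_divide_distrib)
  also have "\<dots> = 1" using pos by (simp add: w \<beta>_def)
  finally have ZQ: "distr ?M borel Z = std_normal_distribution" "distr ?M borel Q = chi_square (n - k)"
      "indep_var borel Q borel Z"
    using iid_std_normal_head_tail[OF iidV \<open>k < n\<close>, of "\<lambda>b. w b / \<beta>"]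
    unfolding Z_def[abs_def] Q_def[abs_def] by simp_all
  define \<mu> where "\<mu> = sqrt (real n) * \<theta> $ i / (\<sigma> * \<xi> X i)"
  define a where "a = sqrt (real n) * \<eta>"
  have \<mu>_eq: "\<mu> = \<theta> $ i / (\<sigma> * \<beta>)" using n by (simp add: \<mu>_def \<xi>)
  have event: "est X i \<eta> (Y \<omega>) = 0 \<longleftrightarrow> \<bar>\<mu> + Z \<omega>\<bar> \<le> a * (sqrt (Q \<omega>) / sqrt (real (n - k)))"
    if \<omega>: "\<omega> \<in> space ?M" for \<omega>
  proof -
    have u: "u \<omega> \<in> carrier_vec n" using Y[OF \<omega>] X \<theta> by (simp add: u_def)
    have Yu: "Y \<omega> = X *\<^sub>v \<theta> + u \<omega>"
      using Y[OF \<omega>] X \<theta> by (intro eq_vecI) (auto simp: u_def)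
    let ?c = "B *\<^sub>v (X\<^sup>T *\<^sub>v u \<omega>)"
    have Xt: "X\<^sup>T \<in> carrier_mat k n" using X by simp
    have c: "?c \<in> carrier_vec k" by (intro mult_mat_vec_carrier[OF B] mult_mat_vec_carrier[OF Xt] u)
    have ls: "ls_estimator X (Y \<omega>) = \<theta> + ?c"
    proof -
      have "X\<^sup>T *\<^sub>v Y \<omega> = X\<^sup>T *\<^sub>v (X *\<^sub>v \<theta>) + X\<^sup>T *\<^sub>v u \<omega>"
        unfolding Yu by (rule mult_add_distrib_mat_vec[OF Xt]) (use X u \<theta> in auto)
      also have "X\<^sup>T *\<^sub>v (X *\<^sub>v \<theta>) = (X\<^sup>T * X) *\<^sub>v \<theta>"
        by (rule assoc_mult_mat_vec[OF Xt X \<theta>, symmetric])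
      finally have "B *\<^sub>v (X\<^sup>T *\<^sub>v Y \<omega>) = B *\<^sub>v ((X\<^sup>T * X) *\<^sub>v \<theta>) + ?c"
        using mult_add_distrib_mat_vec[OF B mult_mat_vec_carrier[OF mult_carrier_mat[OF Xt X] \<theta>]
            mult_mat_vec_carrier[OF Xt u]] by simp
      also have "B *\<^sub>v ((X\<^sup>T * X) *\<^sub>v \<theta>) = (B * (X\<^sup>T * X)) *\<^sub>v \<theta>"
        using B X \<theta> by (intro assoc_mult_mat_vec[symmetric]) auto
      also have "\<dots> = \<theta>" unfolding BA using \<theta> by simp
      finally show ?thesis by (simp add: ls_estimator_def inv)
    qed
    have "?c $ i = \<sigma> * \<beta> * Z \<omega>"
      unfolding estim[OF u] using \<beta> by (simp add: gu Z_def sum_distrib_left mult_ac)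
    then have ls_i: "ls_estimator X (Y \<omega>) $ i = \<theta> $ i + \<sigma> * \<beta> * Z \<omega>"
      unfolding ls using c i by (simp only: index_add_vec(1) carrier_vecD)
    have "X *\<^sub>v ls_estimator X (Y \<omega>) = X *\<^sub>v \<theta> + X *\<^sub>v ?c"
      unfolding ls by (rule mult_add_distrib_mat_vec[OF X \<theta> c])
    then have "Y \<omega> - X *\<^sub>v ls_estimator X (Y \<omega>) = u \<omega> - X *\<^sub>v ?c"
      using mult_mat_vec_carrier[OF X \<theta>] mult_mat_vec_carrier[OF X c] Y[OF \<omega>]
      by (intro eq_vecI) (simp_all add: u_def del: index_mult_mat_vec)
    then have "sigma_hat X (Y \<omega>) = sqrt ((\<Sum>b\<in>{k..<n}. (g (vec_index (u \<omega>)) b)\<^sup>2) / real (n - k))"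
      using X by (simp add: sigma_hat_def Let_def rss[OF u])
    also have "(\<Sum>b\<in>{k..<n}. (g (vec_index (u \<omega>)) b)\<^sup>2) = \<sigma>\<^sup>2 * Q \<omega>"
      by (simp add: gu Q_def power_mult_distrib sum_distrib_left)
    finally have \<sigma>hat: "sigma_hat X (Y \<omega>) = \<sigma> * (sqrt (Q \<omega>) / sqrt (real (n - k)))"
      using \<sigma> by (simp add: real_sqrt_mult real_sqrt_divide)
    have "\<theta> $ i + \<sigma> * \<beta> * Z \<omega> = (\<sigma> * \<beta>) * (\<mu> + Z \<omega>)"
      using \<sigma> \<beta> by (simp add: \<mu>_eq distrib_left)
    then have "\<bar>ls_estimator X (Y \<omega>) $ i\<bar> = (\<sigma> * \<beta>) * \<bar>\<mu> + Z \<omega>\<bar>"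
      unfolding ls_i using \<sigma> \<beta> by (simp add: abs_mult)
    moreover have "sigma_hat X (Y \<omega>) * \<xi> X i * \<eta> = (\<sigma> * \<beta>) * (a * (sqrt (Q \<omega>) / sqrt (real (n - k))))"
      unfolding \<sigma>hat \<xi> a_def by simp
    ultimately show ?thesis
      using estimator_eq_0_iff[OF est, of X i \<eta> "Y \<omega>"] \<xi>_pos \<open>0 < \<eta>\<close> mult_pos_pos[OF \<sigma> \<beta>]
      by (simp only: mult_le_cancel_left_pos less_imp_le)
  qed
  have "\<P>(\<omega> in ?M. est X i \<eta> (Y \<omega>) = 0) = prob {\<omega>\<in>space ?M. \<bar>\<mu> + Z \<omega>\<bar> \<le> a * (sqrt (Q \<omega>) / sqrt (real (n - k)))}"
    by (rule arg_cong[where f=prob]) (use event in auto)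
  also have "\<dots> = studentized_band_prob (n - k) \<mu> a"
    by (rule prob_studentized_band[OF ZQ(3) ZQ(1) ZQ(2)]) (use \<open>0 < \<eta>\<close> in \<open>simp add: a_def\<close>)
  finally show ?thesis
    by (simp only: \<mu>_def a_def)
qed

section \<open>Asymptotic probability of estimating zero\<close>

theorem theorem11:
  fixes n0 :: nat
    and k :: "nat \<Rightarrow> nat"
    and X :: "nat \<Rightarrow> real mat"
    and Y :: "nat \<Rightarrow> 'a \<Rightarrow> real Matrix.vec"
    and P :: "nat \<Rightarrow> real Matrix.vec \<Rightarrow> real \<Rightarrow> 'a measure"
    and \<eta> :: "nat \<Rightarrow> nat \<Rightarrow> real"
    and est :: "real mat \<Rightarrow> nat \<Rightarrow> real \<Rightarrow> real Matrix.vec \<Rightarrow> real"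
    and i :: nat
    and e :: ereal
    and \<theta> :: "nat \<Rightarrow> real Matrix.vec"
    and \<sigma> :: "nat \<Rightarrow> real"
    and p :: "nat \<Rightarrow> real"
  assumes dims: "\<And>n. n \<ge> n0 \<Longrightarrow> 1 \<le> k n \<and> k n < n"
    and design: "\<And>n. n \<ge> n0 \<Longrightarrow> X n \<in> carrier_mat n (k n) \<and> vec_space.rank n (X n) = k n"
    and model: "\<And>n. n \<ge> n0 \<Longrightarrow> gaussian_regression (X n) (Y n) (P n)"
    and tuning: "\<And>n j. n \<ge> n0 \<Longrightarrow> j < k n \<Longrightarrow> \<eta> j n > 0"
    and standing: "\<And>j. (\<forall>\<^sub>F n in sequentially. j < k n) \<Longrightarrow>
          bdd_above ((\<lambda>n. (\<xi> (X n) j)\<^sup>2 / real n) ` {n. n \<ge> n0 \<and> j < k n})"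
    and estimator: "est \<in> {hard_threshold, soft_threshold, adaptive_soft_threshold}"
    and index: "\<forall>\<^sub>F n in sequentially. i < k n"
    and threshold_0: "(\<lambda>n. \<xi> (X n) i * \<eta> i n) \<longlonglongrightarrow> 0"
    and e_nonneg: "0 \<le> e"
    and e_lim: "(\<lambda>n. ereal (sqrt (real n) * \<eta> i n)) \<longlonglongrightarrow> e"
    and true_params: "\<And>n. n \<ge> n0 \<Longrightarrow> \<theta> n \<in> carrier_vec (k n) \<and> \<sigma> n > 0"
    and p_eq: "\<And>n. p n = \<P>(\<omega> in P n (\<theta> n) (\<sigma> n). est (X n) i (\<eta> i n) (Y n \<omega>) = 0)"
  shows
    "(e < \<infinity> \<longrightarrow>
       (\<forall>\<nu>::ereal.
          (\<lambda>n. ereal (sqrt (real n) * \<theta> n $ i / (\<sigma> n * \<xi> (X n) i))) \<longlonglongrightarrow> \<nu> \<longrightarrow>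
          (\<forall>m. (\<forall>\<^sub>F n in sequentially. n - k n = m) \<longrightarrow>
             p \<longlonglongrightarrow> (LBINT s:{0..}. (\<Phi> (- \<nu> + ereal s * e) - \<Phi> (- \<nu> - ereal s * e)) * \<rho> m s)) \<and>
          (filterlim (\<lambda>n. n - k n) at_top sequentially \<longrightarrow>
             p \<longlonglongrightarrow> \<Phi> (- \<nu> + e) - \<Phi> (- \<nu> - e)))) \<and>
     (e = \<infinity> \<longrightarrow>
       (\<forall>\<zeta>::ereal.
          (\<lambda>n. ereal (\<theta> n $ i / (\<sigma> n * \<xi> (X n) i * \<eta> i n))) \<longlonglongrightarrow> \<zeta> \<longrightarrow>
          (\<forall>m. (\<forall>\<^sub>F n in sequentially. n - k n = m) \<longrightarrow>
             p \<longlonglongrightarrow> (LBINT s:{s. \<bar>\<zeta>\<bar> \<le> ereal s}. \<rho> m s) \<and>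
             (LBINT s:{s. \<bar>\<zeta>\<bar> \<le> ereal s}. \<rho> m s) =
               \<P>(x in chi_square m. ereal x > ereal (real m) * \<zeta>\<^sup>2)) \<and>
          (filterlim (\<lambda>n. n - k n) at_top sequentially \<longrightarrow>
             (\<bar>\<zeta>\<bar> < 1 \<longrightarrow> p \<longlonglongrightarrow> 1) \<and>
             (\<bar>\<zeta>\<bar> > 1 \<longrightarrow> p \<longlonglongrightarrow> 0) \<and>
             (\<bar>\<zeta>\<bar> = 1 \<longrightarrow>
               (let r = (\<lambda>n. sqrt (real n) *
                           (\<eta> i n - real_of_ereal \<zeta> * \<theta> n $ i / (\<sigma> n * \<xi> (X n) i)));
                    \<kappa> = (\<lambda>n. sqrt (real n) * \<eta> i n / sqrt (real (n - k n)))
                in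
                  (\<kappa> \<longlonglongrightarrow> 0 \<longrightarrow>
                     (\<forall>r_lim::ereal. (\<lambda>n. ereal (r n)) \<longlonglongrightarrow> r_lim \<longrightarrow> p \<longlonglongrightarrow> \<Phi> r_lim)) \<and>
                  (\<forall>d::real. 0 < d \<longrightarrow> \<kappa> \<longlonglongrightarrow> sqrt 2 * d \<longrightarrow>
                     (\<forall>r_lim::ereal. (\<lambda>n. ereal (r n)) \<longlonglongrightarrow> r_lim \<longrightarrow>
                        p \<longlonglongrightarrow> (LBINT t. \<Phi> (ereal (d * t) + r_lim) * std_normal_density t) \<and>
                        (r_lim = \<infinity> \<longrightarrow>
                           (LBINT t. \<Phi> (ereal (d * t) + r_lim) * std_normal_density t) = 1) \<and>
                        (r_lim = - \<infinity> \<longrightarrow>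
                           (LBINT t. \<Phi> (ereal (d * t) + r_lim) * std_normal_density t) = 0))) \<and>
                  (filterlim \<kappa> at_top sequentially \<longrightarrow>
                     (\<forall>r'::ereal.
                        (\<lambda>n. ereal (inverse (\<kappa> n) * r n)) \<longlonglongrightarrow> ereal (1 / sqrt 2) * r' \<longrightarrow>
                        p \<longlonglongrightarrow> \<Phi> r')))))))"
proof -
  define m where "m n = n - k n" for n
  define a where "a n = sqrt (real n) * \<eta> i n" for n
  define \<mu> where "\<mu> n = sqrt (real n) * \<theta> n $ i / (\<sigma> n * \<xi> (X n) i)" for n
  define z where "z n = \<theta> n $ i / (\<sigma> n * \<xi> (X n) i * \<eta> i n)" for n
  have "\<forall>\<^sub>F n in sequentially. n0 \<le> n" by (rule eventually_ge_at_top)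
  with index have reduce: "\<forall>\<^sub>F n in sequentially.
      studentized_band_prob (m n) (\<mu> n) (a n) = p n \<and> \<mu> n = a n * z n \<and> 0 < m n"
  proof eventually_elim
    fix n assume i: "i < k n" and n: "n0 \<le> n"
    have k: "k n < n" using dims[OF n] by simp
    have X: "X n \<in> carrier_mat n (k n)" and rank: "vec_space.rank n (X n) = k n"
      using design[OF n] by auto
    have \<theta>: "\<theta> n \<in> carrier_vec (k n)" and \<sigma>: "0 < \<sigma> n" using true_params[OF n] by auto
    have \<eta>: "0 < \<eta> i n" by (rule tuning[OF n i])
    note fin = prob_estimator_eq_0[OF X rank k i model[OF n] \<theta> \<sigma> \<eta> estimator]
    have "\<mu> n = a n * z n" using \<eta> by (simp add: \<mu>_def a_def z_def)
    then show "studentized_band_prob (m n) (\<mu> n) (a n) = p n \<and> \<mu> n = a n * z n \<and> 0 < m n"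
      using fin k unfolding p_eq m_def \<mu>_def a_def by simp
  qed
  have transfer: "p \<longlonglongrightarrow> L"
    if "(\<lambda>n. studentized_band_prob (m' n) (\<mu>' n) (a n)) \<longlonglongrightarrow> L"
      and "\<forall>\<^sub>F n in sequentially. studentized_band_prob (m' n) (\<mu>' n) (a n) = studentized_band_prob (m n) (\<mu> n) (a n)" for L m' \<mu>'
  proof (rule Lim_transform_eventually[OF that(1)])
    show "\<forall>\<^sub>F n in sequentially. studentized_band_prob (m' n) (\<mu>' n) (a n) = p n"
      using that(2) reduce by eventually_elim metis
  qed
  have dof_pos: "0 < m'" if "\<forall>\<^sub>F n in sequentially. n - k n = m'" for m'
  proof -
    have "\<forall>\<^sub>F n in sequentially. 0 < m'" using that reduce by eventually_elim (simp add: m_def)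
    then show ?thesis by simp
  qed
  show ?thesis (is "(e < \<infinity> \<longrightarrow> ?A) \<and> (e = \<infinity> \<longrightarrow> ?B)")
  proof (intro conjI impI)
    assume "e < \<infinity>"
    then obtain l where l: "e = ereal l" using e_nonneg by (cases e) auto
    have a: "a \<longlonglongrightarrow> l" using e_lim unfolding l a_def[abs_def] by simp
    show ?A
    proof (intro allI impI conjI)
      fix \<nu> assume "(\<lambda>n. ereal (sqrt (real n) * \<theta> n $ i / (\<sigma> n * \<xi> (X n) i))) \<longlonglongrightarrow> \<nu>"
      then have \<mu>: "(\<lambda>n. ereal (\<mu> n)) \<longlonglongrightarrow> \<nu>" by (simp only: \<mu>_def)
      {
        fix m' assume m': "\<forall>\<^sub>F n in sequentially. n - k n = m'"
        have "\<forall>\<^sub>F n in sequentially. studentized_band_prob m' (\<mu> n) (a n) = studentized_band_prob (m n) (\<mu> n) (a n)"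
          using m' by eventually_elim (simp add: m_def)
        from transfer[OF studentized_band_prob_tendsto_fixed_dof_conservative[OF dof_pos[OF m'] \<mu> a] this]
        show "p \<longlonglongrightarrow> (LBINT s:{0..}. (\<Phi> (- \<nu> + ereal s * e) - \<Phi> (- \<nu> - ereal s * e)) * \<rho> m' s)"
          unfolding l .
      }
      assume "filterlim (\<lambda>n. n - k n) at_top sequentially"
      then have m: "filterlim m at_top sequentially" by (simp only: m_def[abs_def])
      show "p \<longlonglongrightarrow> \<Phi> (- \<nu> + e) - \<Phi> (- \<nu> - e)"
        unfolding l by (rule transfer[OF studentized_band_prob_tendsto_growing_dof_conservative[OF m \<mu> a]]) simp
    qed
  next
    assume e: "e = \<infinity>"
    have a: "filterlim a at_top sequentially"
      using e_lim unfolding e a_def[abs_def] tendsto_PInfty_eq_at_top .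
    show ?B
    proof (intro allI impI)
      fix \<zeta> assume "(\<lambda>n. ereal (\<theta> n $ i / (\<sigma> n * \<xi> (X n) i * \<eta> i n))) \<longlonglongrightarrow> \<zeta>"
      then have z: "(\<lambda>n. ereal (z n)) \<longlonglongrightarrow> \<zeta>" by (simp only: z_def)
      have \<mu>z: "\<forall>\<^sub>F n in sequentially. studentized_band_prob (m n) (a n * z n) (a n) = studentized_band_prob (m n) (\<mu> n) (a n)"
        using reduce by eventually_elim simp
      have fixed: "p \<longlonglongrightarrow> (LBINT s:{s. \<bar>\<zeta>\<bar> \<le> ereal s}. \<rho> m' s) \<and>
             (LBINT s:{s. \<bar>\<zeta>\<bar> \<le> ereal s}. \<rho> m' s) = \<P>(x in chi_square m'. ereal x > ereal (real m') * \<zeta>\<^sup>2)"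
        if m': "\<forall>\<^sub>F n in sequentially. n - k n = m'" for m'
      proof
        have "\<forall>\<^sub>F n in sequentially. studentized_band_prob m' (a n * z n) (a n) = studentized_band_prob (m n) (\<mu> n) (a n)"
          using m' \<mu>z by eventually_elim (simp add: m_def)
        from transfer[OF studentized_band_prob_tendsto_fixed_dof_consistent[OF dof_pos[OF m'] a z] this]
        show "p \<longlonglongrightarrow> (LBINT s:{s. \<bar>\<zeta>\<bar> \<le> ereal s}. \<rho> m' s)" .
        show "(LBINT s:{s. \<bar>\<zeta>\<bar> \<le> ereal s}. \<rho> m' s) = \<P>(x in chi_square m'. ereal x > ereal (real m') * \<zeta>\<^sup>2)"
          by (rule \<rho>_tail_eq_chi_square_tail[OF dof_pos[OF m']])
      qed
      define r where "r n = sqrt (real n) * (\<eta> i n - real_of_ereal \<zeta> * \<theta> n $ i / (\<sigma> n * \<xi> (X n) i))" for n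
      define \<kappa> where "\<kappa> n = sqrt (real n) * \<eta> i n / sqrt (real (n - k n))" for n
      have growing: "(\<bar>\<zeta>\<bar> < 1 \<longrightarrow> p \<longlonglongrightarrow> 1) \<and> (\<bar>\<zeta>\<bar> > 1 \<longrightarrow> p \<longlonglongrightarrow> 0) \<and>
          (\<bar>\<zeta>\<bar> = 1 \<longrightarrow>
             (\<kappa> \<longlonglongrightarrow> 0 \<longrightarrow> (\<forall>R. (\<lambda>n. ereal (r n)) \<longlonglongrightarrow> R \<longrightarrow> p \<longlonglongrightarrow> \<Phi> R)) \<and>
             (\<forall>d. 0 < d \<longrightarrow> \<kappa> \<longlonglongrightarrow> sqrt 2 * d \<longrightarrow> (\<forall>R. (\<lambda>n. ereal (r n)) \<longlonglongrightarrow> R \<longrightarrow>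
                 p \<longlonglongrightarrow> (LBINT t. \<Phi> (ereal (d * t) + R) * std_normal_density t) \<and>
                 (R = \<infinity> \<longrightarrow> (LBINT t. \<Phi> (ereal (d * t) + R) * std_normal_density t) = 1) \<and>
                 (R = - \<infinity> \<longrightarrow> (LBINT t. \<Phi> (ereal (d * t) + R) * std_normal_density t) = 0))) \<and>
             (filterlim \<kappa> at_top sequentially \<longrightarrow>
                 (\<forall>R. (\<lambda>n. ereal (inverse (\<kappa> n) * r n)) \<longlonglongrightarrow> ereal (1 / sqrt 2) * R \<longrightarrow> p \<longlonglongrightarrow> \<Phi> R)))"
        if "filterlim (\<lambda>n. n - k n) at_top sequentially"
      proof -
        have m: "filterlim m at_top sequentially" using that by (simp only: m_def[abs_def])
        have off: "p \<longlonglongrightarrow> of_bool (\<bar>\<zeta>\<bar> < 1)" if "\<bar>\<zeta>\<bar> \<noteq> 1"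
          by (rule transfer[OF studentized_band_prob_tendsto_growing_dof_consistent[OF m a z that] \<mu>z])
        {
          assume "\<bar>\<zeta>\<bar> = 1"
          define s where "s = real_of_ereal \<zeta>"
          have s: "\<zeta> = ereal s" "s = 1 \<or> s = - 1"
            using \<open>\<bar>\<zeta>\<bar> = 1\<close> by (cases \<zeta>; auto simp: s_def one_ereal_def abs_if split: if_splits)+
          have sz: "(\<lambda>n. s * z n) \<longlonglongrightarrow> 1"
            using tendsto_mult[OF tendsto_const[of s] z[unfolded s(1) lim_ereal]] s(2) by auto
          \<comment> \<open>Flipping the sign of the parameter reduces the case \<open>\<zeta> = -1\<close> to \<open>\<zeta> = 1\<close>.\<close>
          have flip: "\<forall>\<^sub>F n in sequentially. studentized_band_prob (m n) (a n * (s * z n)) (a n) = studentized_band_prob (m n) (\<mu> n) (a n)"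
            using \<mu>z by eventually_elim (use s(2) studentized_band_prob_minus in auto)
          have \<kappa>: "\<kappa> = (\<lambda>n. a n / sqrt (real (m n)))"
            by (simp add: \<kappa>_def[abs_def] a_def m_def)
          have r_eq: "\<forall>\<^sub>F n in sequentially. r n = a n * (1 - s * z n)"
            using reduce
          proof eventually_elim
            fix n assume "studentized_band_prob (m n) (\<mu> n) (a n) = p n \<and> \<mu> n = a n * z n \<and> 0 < m n"
            then have "a n * (1 - s * z n) = a n - s * \<mu> n" by (simp add: algebra_simps)
            then show "r n = a n * (1 - s * z n)"
              by (simp add: r_def a_def \<mu>_def s_def right_diff_distrib)
          qed
          have r: "(\<lambda>n. ereal (a n * (1 - s * z n))) \<longlonglongrightarrow> R" if "(\<lambda>n. ereal (r n)) \<longlonglongrightarrow> R" for R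
            by (rule Lim_transform_eventually[OF that]) (use r_eq in eventually_elim, simp)
          have r': "(\<lambda>n. ereal (inverse (a n / sqrt (real (m n))) * (a n * (1 - s * z n)))) \<longlonglongrightarrow> R"
            if "(\<lambda>n. ereal (inverse (\<kappa> n) * r n)) \<longlonglongrightarrow> R" for R
            by (rule Lim_transform_eventually[OF that]) (use r_eq in eventually_elim, simp add: \<kappa>)
          have "p \<longlonglongrightarrow> \<Phi> R" if "\<kappa> \<longlonglongrightarrow> 0" "(\<lambda>n. ereal (r n)) \<longlonglongrightarrow> R" for R
            by (rule transfer[OF studentized_band_prob_tendsto_boundary_small[OF m a sz that(1)[unfolded \<kappa>] r[OF that(2)]] flip])
          moreover have "p \<longlonglongrightarrow> (LBINT t. \<Phi> (ereal (d * t) + R) * std_normal_density t)"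
            if "\<kappa> \<longlonglongrightarrow> sqrt 2 * d" "(\<lambda>n. ereal (r n)) \<longlonglongrightarrow> R" for d R
            by (rule transfer[OF studentized_band_prob_tendsto_boundary_moderate[OF m a sz that(1)[unfolded \<kappa>] r[OF that(2)]] flip])
          moreover have "(LBINT t. \<Phi> (ereal (d * t) + R) * std_normal_density t) = 1" if "R = \<infinity>" for d R
            using that by simp
          moreover have "(LBINT t. \<Phi> (ereal (d * t) + R) * std_normal_density t) = 0" if "R = - \<infinity>" for d R
            using that by simp
          moreover have "p \<longlonglongrightarrow> \<Phi> R"
            if "filterlim \<kappa> at_top sequentially" "(\<lambda>n. ereal (inverse (\<kappa> n) * r n)) \<longlonglongrightarrow> ereal (1 / sqrt 2) * R" for R
            by (rule transfer[OF studentized_band_prob_tendsto_boundary_large[OF m a sz that(1)[unfolded \<kappa>] r'[OF that(2)]] flip])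
          ultimately have "(\<kappa> \<longlonglongrightarrow> 0 \<longrightarrow> (\<forall>R. (\<lambda>n. ereal (r n)) \<longlonglongrightarrow> R \<longrightarrow> p \<longlonglongrightarrow> \<Phi> R)) \<and>
             (\<forall>d. 0 < d \<longrightarrow> \<kappa> \<longlonglongrightarrow> sqrt 2 * d \<longrightarrow> (\<forall>R. (\<lambda>n. ereal (r n)) \<longlonglongrightarrow> R \<longrightarrow>
                 p \<longlonglongrightarrow> (LBINT t. \<Phi> (ereal (d * t) + R) * std_normal_density t) \<and>
                 (R = \<infinity> \<longrightarrow> (LBINT t. \<Phi> (ereal (d * t) + R) * std_normal_density t) = 1) \<and>
                 (R = - \<infinity> \<longrightarrow> (LBINT t. \<Phi> (ereal (d * t) + R) * std_normal_density t) = 0))) \<and>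
             (filterlim \<kappa> at_top sequentially \<longrightarrow>
                 (\<forall>R. (\<lambda>n. ereal (inverse (\<kappa> n) * r n)) \<longlonglongrightarrow> ereal (1 / sqrt 2) * R \<longrightarrow> p \<longlonglongrightarrow> \<Phi> R))"
            by (intro conjI allI impI) assumption+
        }
        note boundary = this
        have below: "p \<longlonglongrightarrow> 1" if "\<bar>\<zeta>\<bar> < 1"
          using off that less_imp_neq[OF that] by simp
        have above: "p \<longlonglongrightarrow> 0" if "\<bar>\<zeta>\<bar> > 1"
          using off that less_imp_neq[OF that] less_not_sym[OF that] by simp
        show ?thesis
          by (intro conjI; rule impI) (erule below above boundary)+
      qed
      show "(\<forall>m. (\<forall>\<^sub>F n in sequentially. n - k n = m) \<longrightarrow>
             p \<longlonglongrightarrow> (LBINT s:{s. \<bar>\<zeta>\<bar> \<le> ereal s}. \<rho> m s) \<and>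
             (LBINT s:{s. \<bar>\<zeta>\<bar> \<le> ereal s}. \<rho> m s) =
               \<P>(x in chi_square m. ereal x > ereal (real m) * \<zeta>\<^sup>2)) \<and>
          (filterlim (\<lambda>n. n - k n) at_top sequentially \<longrightarrow>
             (\<bar>\<zeta>\<bar> < 1 \<longrightarrow> p \<longlonglongrightarrow> 1) \<and>
             (\<bar>\<zeta>\<bar> > 1 \<longrightarrow> p \<longlonglongrightarrow> 0) \<and>
             (\<bar>\<zeta>\<bar> = 1 \<longrightarrow>
               (let r = (\<lambda>n. sqrt (real n) *
                           (\<eta> i n - real_of_ereal \<zeta> * \<theta> n $ i / (\<sigma> n * \<xi> (X n) i)));
                    \<kappa> = (\<lambda>n. sqrt (real n) * \<eta> i n / sqrt (real (n - k n)))
                in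
                  (\<kappa> \<longlonglongrightarrow> 0 \<longrightarrow>
                     (\<forall>r_lim::ereal. (\<lambda>n. ereal (r n)) \<longlonglongrightarrow> r_lim \<longrightarrow> p \<longlonglongrightarrow> \<Phi> r_lim)) \<and>
                  (\<forall>d::real. 0 < d \<longrightarrow> \<kappa> \<longlonglongrightarrow> sqrt 2 * d \<longrightarrow>
                     (\<forall>r_lim::ereal. (\<lambda>n. ereal (r n)) \<longlonglongrightarrow> r_lim \<longrightarrow>
                        p \<longlonglongrightarrow> (LBINT t. \<Phi> (ereal (d * t) + r_lim) * std_normal_density t) \<and>
                        (r_lim = \<infinity> \<longrightarrow>
                           (LBINT t. \<Phi> (ereal (d * t) + r_lim) * std_normal_density t) = 1) \<and>
                        (r_lim = - \<infinity> \<longrightarrow>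
                           (LBINT t. \<Phi> (ereal (d * t) + r_lim) * std_normal_density t) = 0))) \<and>
                  (filterlim \<kappa> at_top sequentially \<longrightarrow>
                     (\<forall>r'::ereal.
                        (\<lambda>n. ereal (inverse (\<kappa> n) * r n)) \<longlonglongrightarrow> ereal (1 / sqrt 2) * r' \<longrightarrow>
                        p \<longlonglongrightarrow> \<Phi> r')))))"
        unfolding Let_def
        by (rule conjI, intro allI impI, erule fixed, rule impI, erule growing[unfolded r_def[abs_def] \<kappa>_def[abs_def]])
    qed
  qed
qed

end
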